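(* Let $k\ge1$ and let $A$ be an anti-symmetric differential operator in the Weyl algebra $W_1$ in $z_1,\dots,z_k$. Then $\delta A\in\Delta W_2$. So any such $A$ belongs to $\delta W_2$.
   Context: $W_1=\mathbb{C}\langle z_1,\dots,z_k,\partial/\partial z_1,\dots,\partial/\partial z_k\rangle$; $\mathfrak{S}_k$ acts on it by permuting simultaneously the $z_j$ and the $\partial/\partial z_j$, and $A\in W_1$ is anti-symmetric if $\tau\cdot A=\operatorname{sgn}(\tau)A$ for all $\tau\in\mathfrak{S}_k$. $\delta=\prod_{1\le i<j\le k}(z_i-z_j)$, $\Delta=\delta^2$. $\sigma_1,\dots,\sigma_k$ are the elementary symmetric functions of $z_1,\dots,z_k$, and $W_2=\mathbb{C}\langle\sigma_1,\dots,\sigma_k,\partial_1,\dots,\partial_k\rangle$ with $\partial_h=\partial/\partial\sigma_h$ is the Weyl algebra in the $\sigma$ variables. Each $\partial_h$ is viewed also as a derivation of the field $\mathbb{C}(z_1,\dots,z_k)$ (the unique extension of $\partial/\partial\sigma_h$ from $\mathbb{C}(\sigma_1,\dots,\sigma_k)$), so that $W_1$ and $W_2$ both lie in the ring of differential operators with coefficients in $\mathbb{C}(z_1,\dots,z_k)$; the containments are understood in this ring. *)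

theory Defs
  imports
    Complex_Main
    "HOL-Library.Cardinality"
    "HOL-Library.Poly_Mapping"
    "HOL-Combinatorics.Permutations"
    "HOL-Computational_Algebra.Polynomial"
    "HOL-Computational_Algebra.Fraction_Field"
begin

section \<open>Polynomials and rational functions in \<open>k\<close> variables\<close>

text \<open>
  The variables are indexed by a finite linearly ordered type \<open>'n\<close>, so that \<open>k = CARD('n) \<ge> 1\<close>.
  The order on \<open>'n\<close> is needed for the integral domain structure and for the sign of the
  Vandermonde product \<open>\<delta>\<close>.
\<close>

type_synonym 'n mpoly = "('n \<Rightarrow>\<^sub>0 nat) \<Rightarrow>\<^sub>0 complex"
type_synonym 'n ratfun = "'n mpoly fract"
type_synonym 'n ratop = "'n ratfun \<Rightarrow> 'n ratfun"

definition const_poly :: "complex \<Rightarrow> 'n mpoly" where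
  "const_poly c = Poly_Mapping.single 0 c"

definition var_poly :: "'n \<Rightarrow> 'n mpoly" where
  "var_poly i = Poly_Mapping.single (Poly_Mapping.single i 1) 1"

definition const_rat :: "complex \<Rightarrow> 'n::{finite,linorder} ratfun" where
  "const_rat c = Fract (const_poly c) 1"

definition zvar :: "'n \<Rightarrow> 'n::{finite,linorder} ratfun" where
  "zvar i = Fract (var_poly i) 1"

lemma mpoly_induct [case_names zero single add]:
  assumes "P 0"
    and "\<And>m c. P (Poly_Mapping.single m c)"
    and "\<And>p q. P p \<Longrightarrow> P q \<Longrightarrow> P (p + q)"
  shows "P (p :: 'a \<Rightarrow>\<^sub>0 'b::comm_monoid_add)"
proof (induction p rule: update_induct)
  case const
  show ?case by fact
next
  case (update p a b)
  have "Poly_Mapping.update a b p = p + Poly_Mapping.single a b"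
    using update by (intro poly_mapping_eqI)
      (auto simp: lookup_update lookup_add lookup_single not_in_keys_iff_lookup_eq_zero when_def in_keys_iff)
  then show ?case using assms update by metis
qed

lemma sum_keys_superset:
  assumes "finite S" "Poly_Mapping.keys p \<subseteq> S" "\<And>m. F m 0 = 0"
  shows "(\<Sum>m\<in>Poly_Mapping.keys p. F m (Poly_Mapping.lookup p m)) = (\<Sum>m\<in>S. F m (Poly_Mapping.lookup p m))"
  using assms by (intro sum.mono_neutral_left) (auto simp: in_keys_iff)

lemma sum_keys_add:
  fixes p q :: "'a \<Rightarrow>\<^sub>0 'b::comm_monoid_add" and F :: "'a \<Rightarrow> 'b \<Rightarrow> 'c::comm_monoid_add"
  assumes "\<And>m. F m 0 = 0" "\<And>m a b. F m (a + b) = F m a + F m b"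
  shows "(\<Sum>m\<in>Poly_Mapping.keys (p + q). F m (Poly_Mapping.lookup (p + q) m)) =
    (\<Sum>m\<in>Poly_Mapping.keys p. F m (Poly_Mapping.lookup p m)) +
    (\<Sum>m\<in>Poly_Mapping.keys q. F m (Poly_Mapping.lookup q m))"
proof -
  let ?S = "Poly_Mapping.keys p \<union> Poly_Mapping.keys q"
  have "(\<Sum>m\<in>Poly_Mapping.keys (p + q). F m (Poly_Mapping.lookup (p + q) m)) =
      (\<Sum>m\<in>?S. F m (Poly_Mapping.lookup (p + q) m))"
    using Poly_Mapping.keys_add[of p q] by (intro sum_keys_superset) (auto simp: assms)
  moreover have "(\<Sum>m\<in>Poly_Mapping.keys p. F m (Poly_Mapping.lookup p m)) =
      (\<Sum>m\<in>?S. F m (Poly_Mapping.lookup p m))"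
    by (intro sum_keys_superset) (auto simp: assms)
  moreover have "(\<Sum>m\<in>Poly_Mapping.keys q. F m (Poly_Mapping.lookup q m)) =
      (\<Sum>m\<in>?S. F m (Poly_Mapping.lookup q m))"
    by (intro sum_keys_superset) (auto simp: assms)
  ultimately show ?thesis by (simp add: lookup_add assms sum.distrib)
qed

section \<open>The partial derivatives \<open>\<partial>/\<partial>z\<^sub>i\<close>\<close>

definition pdiff_poly :: "'n \<Rightarrow> 'n mpoly \<Rightarrow> 'n mpoly" where
  "pdiff_poly i p = (\<Sum>m\<in>Poly_Mapping.keys p.
     Poly_Mapping.single (m - Poly_Mapping.single i 1)
       (of_nat (Poly_Mapping.lookup m i) * Poly_Mapping.lookup p m))"

lemma pdiff_poly_zero [simp]: "pdiff_poly i 0 = 0"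
  by (simp add: pdiff_poly_def)

lemma pdiff_poly_single:
  "pdiff_poly i (Poly_Mapping.single m c) =
     Poly_Mapping.single (m - Poly_Mapping.single i 1) (of_nat (Poly_Mapping.lookup m i) * c)"
  by (cases "c = 0") (auto simp: pdiff_poly_def)

lemma pdiff_poly_add: "pdiff_poly i (p + q) = pdiff_poly i p + pdiff_poly i q"
  unfolding pdiff_poly_def
  by (rule sum_keys_add) (simp_all add: algebra_simps single_add)

lemma pdiff_poly_mult: "pdiff_poly i (p * q) = pdiff_poly i p * q + p * pdiff_poly i q"
proof (induction p rule: mpoly_induct)
  case (single m c)
  show ?case
  proof (induction q rule: mpoly_induct)
    case (single n d)
    let ?e = "Poly_Mapping.single i (1::nat)"
    have 1: "Poly_Mapping.single (m + n - ?e) (of_nat (Poly_Mapping.lookup m i) * x) =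
        Poly_Mapping.single (m - ?e + n) (of_nat (Poly_Mapping.lookup m i) * x)" for x :: complex
    proof (cases "Poly_Mapping.lookup m i = 0")
      case False
      then have "m + n - ?e = m - ?e + n"
        by (intro poly_mapping_eqI) (auto simp: lookup_add lookup_minus lookup_single when_def)
      then show ?thesis by simp
    qed simp
    have 2: "Poly_Mapping.single (m + n - ?e) (of_nat (Poly_Mapping.lookup n i) * x) =
        Poly_Mapping.single (m + (n - ?e)) (of_nat (Poly_Mapping.lookup n i) * x)" for x :: complex
    proof (cases "Poly_Mapping.lookup n i = 0")
      case False
      then have "m + n - ?e = m + (n - ?e)"
        by (intro poly_mapping_eqI) (auto simp: lookup_add lookup_minus lookup_single when_def)
      then show ?thesis by simp
    qed simp
    show ?case
      by (simp only: mult_single pdiff_poly_single lookup_add of_nat_add distrib_right single_add 1 2)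
        (simp add: mult_ac)
  qed (simp_all add: pdiff_poly_add algebra_simps)
qed (simp_all add: pdiff_poly_add algebra_simps)

lift_definition pd_z :: "'n \<Rightarrow> 'n::{finite,linorder} ratop" is
  "\<lambda>i (p, q). (pdiff_poly i p * q - p * pdiff_poly i q, q * q)"
proof (clarsimp)
  fix i :: 'n and p q p' q' :: "'n mpoly"
  assume eq: "p * q' = p' * q"
  let ?d = "pdiff_poly i"
  have "?d p * q' + p * ?d q' = ?d p' * q + p' * ?d q"
    using arg_cong[OF eq, of ?d] by (simp add: pdiff_poly_mult)
  then show "(?d p * q - p * ?d q) * (q' * q') = (?d p' * q' - p' * ?d q') * (q * q)"
    using eq by algebra
qed

lemma pd_z_Fract:
  "q \<noteq> 0 \<Longrightarrow> pd_z i (Fract p q) = Fract (pdiff_poly i p * q - p * pdiff_poly i q) (q * q)"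
  by (simp add: Fract.abs_eq pd_z.abs_eq)

section \<open>The action of permutations\<close>

text \<open>\<open>rename_poly \<tau>\<close> substitutes \<open>z\<^bsub>\<tau> j\<^esub>\<close> for \<open>z\<^sub>j\<close>.\<close>

definition rename_poly :: "('n \<Rightarrow> 'n) \<Rightarrow> 'n::finite mpoly \<Rightarrow> 'n mpoly" where
  "rename_poly \<tau> p = (\<Sum>m\<in>Poly_Mapping.keys p.
     const_poly (Poly_Mapping.lookup p m) * (\<Prod>j\<in>UNIV. var_poly (\<tau> j) ^ Poly_Mapping.lookup m j))"

lemma rename_poly_zero [simp]: "rename_poly \<tau> 0 = 0"
  by (simp add: rename_poly_def)

lemma const_poly_add: "const_poly (a + b) = const_poly a + const_poly b"
  by (simp add: const_poly_def single_add)

lemma const_poly_mult: "const_poly (a * b) = const_poly a * const_poly b"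
  by (simp add: const_poly_def mult_single)

lemma const_poly_0 [simp]: "const_poly 0 = 0" and const_poly_1 [simp]: "const_poly 1 = 1"
  by (simp_all add: const_poly_def)

lemma rename_poly_single:
  "rename_poly \<tau> (Poly_Mapping.single m c) =
     const_poly c * (\<Prod>j\<in>UNIV. var_poly (\<tau> j) ^ Poly_Mapping.lookup m j)"
  by (cases "c = 0") (auto simp: rename_poly_def)

lemma rename_poly_add: "rename_poly \<tau> (p + q) = rename_poly \<tau> p + rename_poly \<tau> q"
  unfolding rename_poly_def
  by (rule sum_keys_add) (simp_all add: algebra_simps const_poly_add)

lemma rename_poly_mult: "rename_poly \<tau> (p * q) = rename_poly \<tau> p * rename_poly \<tau> q"
proof (induction p rule: mpoly_induct)
  case (single m c)
  show ?case
    by (induction q rule: mpoly_induct)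
      (simp_all add: mult_single rename_poly_single rename_poly_add lookup_add power_add
        prod.distrib const_poly_mult algebra_simps)
qed (simp_all add: rename_poly_add algebra_simps)

lemma rename_poly_const [simp]: "rename_poly \<tau> (const_poly c) = const_poly c"
  unfolding const_poly_def[of c] by (simp add: rename_poly_single) (simp add: const_poly_def)

lemma rename_poly_1 [simp]: "rename_poly \<tau> 1 = 1"
  using rename_poly_const[of \<tau> 1] by simp

lemma rename_poly_var [simp]: "rename_poly \<tau> (var_poly i) = var_poly (\<tau> i)"
proof -
  have "rename_poly \<tau> (var_poly i) = (\<Prod>j\<in>UNIV. if j = i then var_poly (\<tau> j) else 1)"
    unfolding var_poly_def[of i] rename_poly_single
    by (simp only: const_poly_1 mult_1_left, intro prod.cong) (auto simp: lookup_single when_def)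
  then show ?thesis by simp
qed

lemma var_poly_power: "var_poly i ^ n = Poly_Mapping.single (Poly_Mapping.single i n) 1"
  by (induction n) (simp_all add: var_poly_def mult_single flip: single_add)

lemma monomial_eq_prod:
  fixes m :: "'n::finite \<Rightarrow>\<^sub>0 nat"
  shows "Poly_Mapping.single m c = const_poly c * (\<Prod>j\<in>UNIV. var_poly j ^ Poly_Mapping.lookup m j)"
proof -
  have *: "(\<Prod>j\<in>S. Poly_Mapping.single (Poly_Mapping.single j (Poly_Mapping.lookup m j)) (1::complex)) =
      Poly_Mapping.single (\<Sum>j\<in>S. Poly_Mapping.single j (Poly_Mapping.lookup m j)) 1" for S
    by (induction S rule: infinite_finite_induct) (simp_all add: mult_single)
  have "(\<Sum>j\<in>UNIV. Poly_Mapping.single j (Poly_Mapping.lookup m j)) = m"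
    by (intro poly_mapping_eqI) (simp add: lookup_sum lookup_single when_def)
  then show ?thesis by (simp add: var_poly_power * const_poly_def mult_single)
qed

lemma rename_poly_power: "rename_poly \<tau> (p ^ n) = rename_poly \<tau> p ^ n"
  by (induction n) (simp_all add: rename_poly_mult)

lemma rename_poly_prod: "rename_poly \<tau> (\<Prod>j\<in>S. f j) = (\<Prod>j\<in>S. rename_poly \<tau> (f j))"
  by (induction S rule: infinite_finite_induct) (simp_all add: rename_poly_mult)

lemma rename_poly_id: "rename_poly id p = p"
  by (induction p rule: mpoly_induct)
    (simp_all add: rename_poly_add rename_poly_single flip: monomial_eq_prod)

lemma rename_poly_comp: "rename_poly \<rho> (rename_poly \<tau> p) = rename_poly (\<rho> \<circ> \<tau>) p"
  by (induction p rule: mpoly_induct)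
    (simp_all add: rename_poly_add rename_poly_single rename_poly_mult rename_poly_prod rename_poly_power)

lemma rename_poly_eq_0_iff:
  assumes "bij \<tau>" shows "rename_poly \<tau> p = 0 \<longleftrightarrow> p = 0"
proof
  assume "rename_poly \<tau> p = 0"
  then have "rename_poly (inv \<tau>) (rename_poly \<tau> p) = 0" by simp
  then show "p = 0"
    using assms by (simp add: rename_poly_comp bij_is_inj rename_poly_id)
qed simp

text \<open>Only bijections \<open>\<tau>\<close> matter; others need not preserve nonzero denominators.\<close>

lift_definition perm_rat :: "('n \<Rightarrow> 'n) \<Rightarrow> 'n::{finite,linorder} ratop" is
  "\<lambda>\<tau> (p, q). if bij \<tau> then (rename_poly \<tau> p, rename_poly \<tau> q) else (p, q)"
  by (auto simp: rename_poly_eq_0_iff split: if_splits simp flip: rename_poly_mult)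

lemma perm_rat_Fract:
  "bij \<tau> \<Longrightarrow> q \<noteq> 0 \<Longrightarrow> perm_rat \<tau> (Fract p q) = Fract (rename_poly \<tau> p) (rename_poly \<tau> q)"
  by (simp add: Fract.abs_eq perm_rat.abs_eq rename_poly_eq_0_iff)

section \<open>Operators on \<open>\<complex>(z)\<close>\<close>

text \<open>
  A differential operator with coefficients in \<open>\<complex>(z)\<close> is represented by the
  endomorphism of \<open>\<complex>(z)\<close> which it induces; this representation is faithful.  Multiplication of
  operators is composition, and a function \<open>f\<close> is identified with \<open>mult_op f\<close>.
\<close>

definition mult_op :: "'n::{finite,linorder} ratfun \<Rightarrow> 'n ratop" where
  "mult_op f = (\<lambda>g. f * g)"

inductive_set op_algebra :: "'n::{finite,linorder} ratop set \<Rightarrow> 'n ratop set"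
  for G :: "'n ratop set" where
  scalar: "mult_op (const_rat c) \<in> op_algebra G"
| generator: "P \<in> G \<Longrightarrow> P \<in> op_algebra G"
| add: "P \<in> op_algebra G \<Longrightarrow> Q \<in> op_algebra G \<Longrightarrow> (\<lambda>f. P f + Q f) \<in> op_algebra G"
| mult: "P \<in> op_algebra G \<Longrightarrow> Q \<in> op_algebra G \<Longrightarrow> P \<circ> Q \<in> op_algebra G"

definition W1 :: "'n::{finite,linorder} ratop set" where
  "W1 = op_algebra (range (\<lambda>i. mult_op (zvar i)) \<union> range pd_z)"

text \<open>
  Conjugation by \<open>\<tau>\<close> is an algebra automorphism sending \<open>z\<^sub>i\<close> to \<open>z\<^bsub>\<tau> i\<^esub>\<close> and \<open>\<partial>/\<partial>z\<^sub>i\<close> to \<open>\<partial>/\<partial>z\<^bsub>\<tau> i\<^esub>\<close>;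
  see \<open>perm_op_simps\<close>.
\<close>

definition perm_op :: "('n \<Rightarrow> 'n) \<Rightarrow> 'n::{finite,linorder} ratop \<Rightarrow> 'n ratop" where
  "perm_op \<tau> A = perm_rat \<tau> \<circ> A \<circ> perm_rat (inv \<tau>)"

definition antisymmetric_op :: "'n::{finite,linorder} ratop \<Rightarrow> bool" where
  "antisymmetric_op A \<longleftrightarrow>
     (\<forall>\<tau>. \<tau> permutes UNIV \<longrightarrow> perm_op \<tau> A = mult_op (of_int (sign \<tau>)) \<circ> A)"

definition delta :: "'n::{finite,linorder} ratfun" where
  "delta = (\<Prod>(i, j)\<in>{(i, j). i < j}. zvar i - zvar j)"

definition Delta :: "'n::{finite,linorder} ratfun" where
  "Delta = delta ^ 2"

definition sigma :: "nat \<Rightarrow> 'n::{finite,linorder} ratfun" where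
  "sigma h = (\<Sum>S | S \<subseteq> UNIV \<and> card S = h. \<Prod>i\<in>S. zvar i)"

definition derivation :: "'n::{finite,linorder} ratop \<Rightarrow> bool" where
  "derivation D \<longleftrightarrow>
     (\<forall>f g. D (f + g) = D f + D g) \<and>
     (\<forall>f g. D (f * g) = D f * g + f * D g) \<and>
     (\<forall>c. D (const_rat c) = 0)"

lemma const_rat_add: "const_rat (a + b) = const_rat a + const_rat b"
  and const_rat_mult: "const_rat (a * b) = const_rat a * const_rat b"
  by (simp_all add: const_rat_def const_poly_add const_poly_mult)

lemma const_rat_0 [simp]: "const_rat 0 = 0" and const_rat_1 [simp]: "const_rat 1 = 1"
  by (simp_all add: const_rat_def Zero_fract_def One_fract_def)

lemma derivation_pd_z: "derivation (pd_z i)"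
  unfolding derivation_def
proof (intro conjI allI)
  fix f g :: "'a ratfun"
  obtain a b where f: "f = Fract a b" "b \<noteq> 0" by (cases f) auto
  obtain c d where g: "g = Fract c d" "d \<noteq> 0" by (cases g) auto
  show "pd_z i (f + g) = pd_z i f + pd_z i g"
    using f g by (simp add: pd_z_Fract eq_fract pdiff_poly_add pdiff_poly_mult algebra_simps)
  show "pd_z i (f * g) = pd_z i f * g + f * pd_z i g"
    using f g by (simp add: pd_z_Fract eq_fract pdiff_poly_add pdiff_poly_mult algebra_simps)
next
  fix c :: complex
  have "pdiff_poly i (const_poly c) = 0" for c :: complex
    by (simp add: const_poly_def pdiff_poly_single)
  from this[of c] this[of 1] show "pd_z i (const_rat c) = 0"
    by (simp add: const_rat_def pd_z_Fract Zero_fract_def eq_fract)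
qed

lemma pd_z_zvar: "pd_z i (zvar j) = (if i = j then 1 else 0)"
proof -
  have "pdiff_poly i (1 :: 'a mpoly) = 0"
    by (simp add: pdiff_poly_single flip: single_one)
  then show ?thesis
    by (auto simp: zvar_def pd_z_Fract var_poly_def pdiff_poly_single lookup_single when_def
        Zero_fract_def One_fract_def eq_fract)
qed

lemma perm_rat_simps:
  fixes f g :: "'n::{finite,linorder} ratfun"
  assumes "bij \<tau>"
  shows "perm_rat \<tau> (f + g) = perm_rat \<tau> f + perm_rat \<tau> g"
    and "perm_rat \<tau> (f * g) = perm_rat \<tau> f * perm_rat \<tau> g"
    and "perm_rat \<tau> (const_rat c) = const_rat c"
    and "perm_rat \<tau> (zvar i) = zvar (\<tau> i)"
proof -
  obtain a b where f: "f = Fract a b" "b \<noteq> 0" by (cases f) auto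
  obtain c d where g: "g = Fract c d" "d \<noteq> 0" by (cases g) auto
  show "perm_rat \<tau> (f + g) = perm_rat \<tau> f + perm_rat \<tau> g"
    "perm_rat \<tau> (f * g) = perm_rat \<tau> f * perm_rat \<tau> g"
    using f g assms
    by (simp_all add: perm_rat_Fract rename_poly_add rename_poly_mult rename_poly_eq_0_iff)
qed (simp_all add: assms const_rat_def zvar_def perm_rat_Fract)

lemma perm_rat_comp: "bij \<rho> \<Longrightarrow> bij \<tau> \<Longrightarrow> perm_rat \<rho> (perm_rat \<tau> f) = perm_rat (\<rho> \<circ> \<tau>) f"
  by (cases f) (simp add: perm_rat_Fract rename_poly_eq_0_iff rename_poly_comp bij_comp)

lemma perm_rat_id: "perm_rat id f = f"
  by (cases f) (simp add: perm_rat_Fract rename_poly_id)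

lemma derivation_simps:
  assumes "derivation D"
  shows "D (f + g) = D f + D g" "D (f * g) = D f * g + f * D g" "D (const_rat c) = 0"
    "D 0 = 0" "D 1 = 0" "D (- f) = - D f" "D (f - g) = D f - D g"
proof -
  show 1: "D (f + g) = D f + D g" "D (f * g) = D f * g + f * D g" "D (const_rat c) = 0" for f g c
    using assms by (auto simp: derivation_def)
  from 1(3)[of 0] 1(3)[of 1] show 2: "D 0 = 0" "D 1 = 0" by simp_all
  from 1(1)[of f "- f"] 2 show 3: "D (- f) = - D f" for f
    by (metis add.right_inverse 1(1) eq_neg_iff_add_eq_0 add.commute)
  show "D (f - g) = D f - D g"
    using 1(1)[of f "- g"] 3 by simp
qed

lemma derivation_power:
  assumes "derivation D" shows "D (f ^ n) = of_nat n * f ^ (n - 1) * D f"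
proof (induction n)
  case (Suc n)
  then show ?case
    by (cases n) (simp_all add: derivation_simps[OF assms] algebra_simps)
qed (simp add: derivation_simps[OF assms])

lemma derivation_sum:
  assumes "derivation D" shows "D (\<Sum>x\<in>S. f x) = (\<Sum>x\<in>S. D (f x))"
  by (induction S rule: infinite_finite_induct) (simp_all add: derivation_simps[OF assms])

lemma Fract_1_hom:
  "Fract (p + q) 1 = Fract p 1 + Fract q 1"
  "Fract (p * q) 1 = Fract p 1 * Fract q 1"
  by simp_all

lemma derivation_eqI:
  fixes D E :: "'n::{finite,linorder} ratop"
  assumes D: "derivation D" and E: "derivation E" and eq: "\<And>i. D (zvar i) = E (zvar i)"
  shows "D = E"
proof
  fix f :: "'n ratfun"
  let ?P = "\<lambda>p. D (Fract p 1) = E (Fract p 1)"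
  note simps = derivation_simps[OF D] derivation_simps[OF E]
  have mult: "?P (p * q)" if "?P p" "?P q" for p q
    using that by (simp add: Fract_1_hom simps del: mult_fract)
  have one: "?P 1" by (simp add: simps flip: One_fract_def)
  have power: "?P (p ^ n)" if "?P p" for p n
    by (induction n) (auto intro: mult that one)
  have prod: "?P (\<Prod>j\<in>S. g j)" if "\<And>j. ?P (g j)" for g and S :: "'n set"
    by (induction S rule: infinite_finite_induct) (auto intro: mult that one)
  have const: "?P (const_poly c)" for c
    by (simp add: simps flip: const_rat_def)
  have var: "?P (var_poly i)" for i
    using eq by (simp flip: zvar_def)
  have poly: "?P p" for p
  proof (induction p rule: mpoly_induct)
    case (single m c)
    show ?case
      by (subst (1 2) monomial_eq_prod) (intro mult const prod power var)
  qed (simp_all add: Fract_1_hom simps flip: Zero_fract_def del: add_fract)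
  obtain a b where f: "f = Fract a b" "b \<noteq> 0" by (cases f) auto
  have "f * Fract b 1 = Fract a 1"
    using f by (simp add: eq_fract)
  then have "D (f * Fract b 1) = E (f * Fract b 1)"
    using poly by metis
  then have "D f * Fract b 1 = E f * Fract b 1"
    using poly[of b] by (simp add: simps)
  moreover have "Fract b 1 \<noteq> 0"
    using f by (simp add: Zero_fract_def eq_fract)
  ultimately show "D f = E f" by simp
qed

lemma perm_op_simps:
  assumes "bij \<tau>"
  shows "perm_op \<tau> (A \<circ> B) = perm_op \<tau> A \<circ> perm_op \<tau> B"
    and "perm_op \<tau> (\<lambda>f. A f + B f) = (\<lambda>f. perm_op \<tau> A f + perm_op \<tau> B f)"
    and "perm_op \<tau> (mult_op (const_rat c)) = mult_op (const_rat c)"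
    and "perm_op \<tau> (mult_op (zvar i)) = mult_op (zvar (\<tau> i))"
    and "perm_op \<tau> (pd_z i) = pd_z (\<tau> i)"
proof -
  have inv: "bij (inv \<tau>)" using assms by (rule bij_imp_bij_inv)
  have [simp]: "perm_rat (inv \<tau>) (perm_rat \<tau> f) = f" "perm_rat \<tau> (perm_rat (inv \<tau>) f) = f" for f
    using assms inv
    by (simp_all add: perm_rat_comp perm_rat_id bij_is_inj surj_iff[THEN iffD1, OF bij_is_surj])
  note [simp] = perm_rat_simps[OF assms] perm_rat_simps[OF inv]
  show "perm_op \<tau> (A \<circ> B) = perm_op \<tau> A \<circ> perm_op \<tau> B"
    "perm_op \<tau> (\<lambda>f. A f + B f) = (\<lambda>f. perm_op \<tau> A f + perm_op \<tau> B f)"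
    "perm_op \<tau> (mult_op (const_rat c)) = mult_op (const_rat c)"
    "perm_op \<tau> (mult_op (zvar i)) = mult_op (zvar (\<tau> i))"
    by (auto simp: perm_op_def mult_op_def fun_eq_iff)
  note [simp] = derivation_simps[OF derivation_pd_z]
  show "perm_op \<tau> (pd_z i) = pd_z (\<tau> i)"
  proof (rule derivation_eqI)
    show "derivation (perm_op \<tau> (pd_z i))"
      by (auto simp: derivation_def perm_op_def)
         (metis const_rat_0 perm_rat_simps(3)[OF assms])
    fix j
    have "i = inv \<tau> j \<longleftrightarrow> \<tau> i = j"
      using assms by (metis bij_inv_eq_iff)
    then show "perm_op \<tau> (pd_z i) (zvar j) = pd_z (\<tau> i) (zvar j)"
      using perm_rat_simps(3)[OF assms, of 0] perm_rat_simps(3)[OF assms, of 1]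
      by (simp add: perm_op_def pd_z_zvar)
  qed (rule derivation_pd_z)
qed

text \<open>
  The coefficients of \<open>\<Prod>\<^sub>i (X - z\<^sub>i)\<close> are the \<open>\<plusminus>\<sigma>\<^sub>h\<close>.  Differentiating \<open>\<Prod>\<^sub>i (z\<^sub>j - z\<^sub>i) = 0\<close> expresses \<open>D z\<^sub>j\<close>
  through the \<open>D \<sigma>\<^sub>h\<close> for any derivation \<open>D\<close>.
\<close>

definition zpoly :: "'n::{finite,linorder} ratfun poly" where
  "zpoly = (\<Prod>i\<in>UNIV. [:- zvar i, 1:])"

lemma inj_zvar: "inj zvar"
  by (rule injI) (metis pd_z_zvar zero_neq_one)

lemma poly_zpoly: "poly zpoly (zvar i) = 0"
  by (auto simp: zpoly_def poly_prod)

lemma pderiv_zpoly_neq_0: "poly (pderiv zpoly) (zvar i) \<noteq> 0"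
proof -
  have "poly (pderiv zpoly) (zvar i) = (\<Sum>a\<in>UNIV. \<Prod>j\<in>UNIV - {a}. zvar i - zvar j)"
    by (simp add: zpoly_def pderiv_prod poly_sum poly_prod pderiv_pCons)
  also have "\<dots> = (\<Sum>a\<in>UNIV. if a = i then \<Prod>j\<in>UNIV - {i}. zvar i - zvar j else 0)"
    by (intro sum.cong) auto
  also have "\<dots> = (\<Prod>j\<in>UNIV - {i}. zvar i - zvar j)" by simp
  also have "\<dots> \<noteq> 0"
    by (auto simp: inj_eq[OF inj_zvar])
  finally show ?thesis .
qed

lemma zpoly_eq:
  "zpoly = (\<Sum>h\<le>CARD('n). monom ((-1) ^ h * sigma h) (CARD('n) - h) :: 'n::{finite,linorder} ratfun poly)"
proof -
  have "zpoly = (\<Prod>i\<in>(UNIV::'n set). [:0, 1:] - [:zvar i:])"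
    by (simp add: zpoly_def)
  also have "\<dots> = (\<Sum>S\<in>Pow (UNIV::'n set). (-1) ^ card S * (\<Prod>i\<in>S. [:zvar i:]) * (\<Prod>i\<in>UNIV - S. [:0, 1:]))"
    by (rule prod_diff_conv_sum) simp
  also have "\<dots> = (\<Sum>S\<in>Pow (UNIV::'n set). monom ((-1) ^ card S * (\<Prod>i\<in>S. zvar i)) (CARD('n) - card S))"
  proof (intro sum.cong refl)
    fix S :: "'n set"
    have "(\<Prod>i\<in>S. [:zvar i:]) = [:\<Prod>i\<in>S. zvar i:]"
      by (induction S rule: infinite_finite_induct) (simp_all add: one_pCons)
    moreover have "[:0, 1:] ^ n = monom (1 :: 'n ratfun) n" for n
      by (simp add: monom_altdef)
    moreover have "(-1 :: 'n ratfun poly) ^ n = [:(-1) ^ n:]" for n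
      by (induction n) (simp_all add: one_pCons)
    ultimately show "(-1) ^ card S * (\<Prod>i\<in>S. [:zvar i:]) * (\<Prod>i\<in>UNIV - S. [:0, 1:]) =
        monom ((-1) ^ card S * (\<Prod>i\<in>S. zvar i)) (CARD('n) - card S)"
      by (simp add: card_Diff_subset smult_monom)
  qed
  also have "\<dots> = (\<Sum>h\<le>CARD('n). \<Sum>S | S \<in> Pow (UNIV::'n set) \<and> card S = h.
      monom ((-1) ^ card S * (\<Prod>i\<in>S. zvar i)) (CARD('n) - card S))"
    by (rule sum.group[symmetric]) (auto intro: card_mono)
  also have "\<dots> = (\<Sum>h\<le>CARD('n). monom ((-1) ^ h * sigma h) (CARD('n) - h))"
    by (intro sum.cong refl) (simp add: sigma_def sum_distrib_left monom_sum)
  finally show ?thesis .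
qed

lemma derivation_zpoly:
  assumes D: "derivation D"
  shows "(\<Sum>h\<in>{1..CARD('n)}. (-1) ^ h * D (sigma h) * zvar i ^ (CARD('n) - h)) +
    poly (pderiv zpoly) (zvar i) * D (zvar i :: 'n::{finite,linorder} ratfun) = 0"
proof -
  note simps = derivation_simps[OF D]
  have m1: "D ((-1) ^ n) = 0" for n
    by (induction n) (simp_all add: simps)
  have s0: "D (sigma 0) = 0"
  proof -
    have "{S :: 'n set. S \<subseteq> UNIV \<and> card S = 0} = {{}}" by auto
    then show ?thesis by (simp add: sigma_def simps)
  qed
  have "0 = D (poly zpoly (zvar i))"
    by (simp add: poly_zpoly simps)
  also have "\<dots> = (\<Sum>h\<le>CARD('n). (-1) ^ h * D (sigma h) * zvar i ^ (CARD('n) - h)) +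
      poly (pderiv zpoly) (zvar i) * D (zvar i)"
  proof -
    let ?x = "zvar i"
    have "D (poly zpoly ?x) = (\<Sum>h\<le>CARD('n). D ((-1) ^ h * sigma h * ?x ^ (CARD('n) - h)))"
      by (simp add: zpoly_eq poly_sum poly_monom derivation_sum[OF D])
    also have "\<dots> = (\<Sum>h\<le>CARD('n). (-1) ^ h * D (sigma h) * ?x ^ (CARD('n) - h) +
        poly (pderiv (monom ((-1) ^ h * sigma h) (CARD('n) - h))) ?x * D ?x)"
      by (intro sum.cong refl)
        (simp only: simps m1 derivation_power[OF D] pderiv_monom poly_monom,
         simp add: algebra_simps del: of_nat_diff)
    also have "\<dots> = (\<Sum>h\<le>CARD('n). (-1) ^ h * D (sigma h) * ?x ^ (CARD('n) - h)) +
        poly (pderiv zpoly) ?x * D ?x"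
      unfolding zpoly_eq higher_pderiv_sum[where n = 1, simplified] poly_sum sum_distrib_right sum.distrib ..
    finally show ?thesis .
  qed
  also have "(\<Sum>h\<le>CARD('n). (-1) ^ h * D (sigma h) * zvar i ^ (CARD('n) - h)) =
      (\<Sum>h\<in>{1..CARD('n)}. (-1) ^ h * D (sigma h) * zvar i ^ (CARD('n) - h))"
  proof (rule sum.mono_neutral_right)
    show "\<forall>h\<in>{..CARD('n)} - {1..CARD('n)}. (-1) ^ h * D (sigma h) * zvar i ^ (CARD('n) - h) = 0"
      using s0 by (auto simp: not_le)
  qed auto
  finally show ?thesis by simp
qed

lemma ex1_pd_sigma:
  assumes h: "h \<in> {1..CARD('n)}"
  shows "\<exists>!D :: 'n::{finite,linorder} ratop. derivation D \<and>
    (\<forall>j\<in>{1..CARD('n)}. D (sigma j) = (if j = h then 1 else 0))"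
proof (rule ex_ex1I)
  define k where "k = CARD('n)"
  {
    fix D E :: "'n ratop"
    assume D: "derivation D \<and> (\<forall>j\<in>{1..CARD('n)}. D (sigma j) = (if j = h then 1 else 0))"
      and E: "derivation E \<and> (\<forall>j\<in>{1..CARD('n)}. E (sigma j) = (if j = h then 1 else 0))"
    show "D = E"
    proof (rule derivation_eqI)
      fix i
      have "(\<Sum>j\<in>{1..CARD('n)}. (-1) ^ j * D (sigma j) * zvar i ^ (CARD('n) - j)) =
          (\<Sum>j\<in>{1..CARD('n)}. (-1) ^ j * E (sigma j) * zvar i ^ (CARD('n) - j))"
        using D E by (intro sum.cong) auto
      then have "poly (pderiv zpoly) (zvar i) * D (zvar i) = poly (pderiv zpoly) (zvar i) * E (zvar i)"
        using derivation_zpoly[OF conjunct1[OF D], of i] derivation_zpoly[OF conjunct1[OF E], of i]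
        by (simp only: add_eq_0_iff)
      then show "D (zvar i) = E (zvar i)"
        by (simp add: pderiv_zpoly_neq_0)
    qed (use D E in auto)
  }
  define v :: "'n \<Rightarrow> 'n ratfun" where
    "v i = - ((-1) ^ h * zvar i ^ (k - h)) / poly (pderiv zpoly) (zvar i)" for i
  define D :: "'n ratop" where "D = (\<lambda>f. \<Sum>i\<in>UNIV. v i * pd_z i f)"
  have D: "derivation D"
    by (simp add: derivation_def D_def derivation_simps[OF derivation_pd_z] sum_distrib_left
        sum_distrib_right distrib_left mult_ac flip: sum.distrib)
  have Dz: "D (zvar i) = v i" for i
    by (simp add: D_def pd_z_zvar if_distrib cong: if_cong)
  let ?p = "(\<Sum>j\<in>{1..k}. monom ((-1) ^ j * D (sigma j)) (k - j))"
  let ?q = "monom ((-1) ^ h) (k - h) :: 'n ratfun poly"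
  have deg: "degree (monom c (k - j) :: 'n ratfun poly) < k" if "j \<in> {1..k}" for c j
    using that by (intro le_less_trans[OF degree_monom_le]) auto
  have k: "0 < k" by (simp add: k_def)
  have "?p = ?q"
  proof (rule poly_eqI_degree)
    fix x :: "'n ratfun" assume "x \<in> range zvar"
    then obtain i where x: "x = zvar i" by auto
    show "poly ?p x = poly ?q x"
      using derivation_zpoly[OF D, of i] pderiv_zpoly_neq_0[of i]
      by (simp add: x poly_sum poly_monom Dz v_def k_def)
  next
    have card: "card (range (zvar :: 'n \<Rightarrow> _)) = k"
      by (simp add: card_image[OF inj_zvar] k_def)
    show "degree ?p < card (range (zvar :: 'n \<Rightarrow> _))"
      unfolding card using k deg by (intro degree_sum_less) auto
    show "degree ?q < card (range (zvar :: 'n \<Rightarrow> _))"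
      unfolding card using deg h by (auto simp: k_def)
  qed
  have "D (sigma j) = (if j = h then 1 else 0)" if j: "j \<in> {1..k}" for j
  proof -
    have "coeff ?p (k - j) = (\<Sum>l\<in>{1..k}. if l = j then (-1) ^ j * D (sigma j) else 0)"
      unfolding coeff_sum using j by (intro sum.cong) auto
    also have "\<dots> = (-1) ^ j * D (sigma j)"
      using j by simp
    also have "coeff ?p (k - j) = (if j = h then (-1) ^ h else 0)"
      unfolding \<open>?p = ?q\<close> using j h by (auto simp: k_def)
    finally show ?thesis by (auto split: if_splits)
  qed
  then show "\<exists>D :: 'n ratop. derivation D \<and> (\<forall>j\<in>{1..CARD('n)}. D (sigma j) = (if j = h then 1 else 0))"
    using D unfolding k_def by blast
qed

text \<open>
  On \<open>\<complex>(\<sigma>)\<close> the derivation \<open>\<partial>/\<partial>\<sigma>\<^sub>h\<close> is determined by its values on the \<open>\<sigma>\<^sub>j\<close>.  Existence and uniqueness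
  of the extension to \<open>\<complex>(z)\<close> is \<open>ex1_pd_sigma\<close>.
\<close>

definition pd_sigma :: "nat \<Rightarrow> 'n::{finite,linorder} ratop" where
  "pd_sigma h = (THE D. derivation D \<and>
     (\<forall>j\<in>{1..CARD('n)}. D (sigma j) = (if j = h then 1 else 0)))"

definition W2 :: "'n::{finite,linorder} ratop set" where
  "W2 = op_algebra ((\<lambda>h. mult_op (sigma h)) ` {1..CARD('n)} \<union> pd_sigma ` {1..CARD('n)})"

end

theory Submission
  imports Defs "HOL-Library.Multiset"
begin

text \<open>
  The operator \<open>P = \<delta>\<^sup>-\<^sup>1 A\<close> is a combination \<open>\<Sum>\<^sub>M c\<^sub>M \<partial>\<^sup>M\<close> of monomials in the \<open>\<partial>\<^sub>h\<close> with coefficients in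
  \<open>\<complex>(z)\<close>, since \<open>\<partial>/\<partial>z\<^sub>i = \<Sum>\<^sub>h (\<partial>\<sigma>\<^sub>h/\<partial>z\<^sub>i) \<partial>\<^sub>h\<close>.  It maps \<open>\<complex>[\<sigma>]\<close> to itself: for symmetric \<open>s\<close> the polynomial
  \<open>A s\<close> is anti-symmetric, hence lies in \<open>\<delta> \<complex>[\<sigma>]\<close>.  Evaluating \<open>P\<close> on the monomials in the \<open>\<sigma>\<^sub>h\<close> then
  gives \<open>c\<^sub>M \<in> \<complex>[\<sigma>]\<close>, by induction on the degree of \<open>M\<close>.

  That anti-symmetric polynomials lie in \<open>\<delta> \<complex>[\<sigma>]\<close> needs neither unique factorization nor the fundamental
  theorem on symmetric polynomials: \<open>\<complex>[z]\<close> is spanned over \<open>\<complex>[\<sigma>]\<close> by the monomials with exponents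
  \<open>< k\<close>, and the alternating sum over the orbit of such a monomial is a constant multiple of \<open>\<delta>\<close>.
\<close>

section \<open>Constants and the action of permutations on the field \<complex>(z)\<close>

lemma const_rat_of_nat: "const_rat (of_nat n) = of_nat n"
  by (induction n) (simp_all add: const_rat_add)

lemma const_rat_uminus: "const_rat (- c) = - const_rat c"
proof -
  have "const_rat (- c) + const_rat c = const_rat (- c + c)"
    by (simp only: const_rat_add)
  then show ?thesis by (simp add: eq_neg_iff_add_eq_0)
qed

lemma const_rat_of_int: "const_rat (of_int n) = of_int n"
  by (cases n rule: int_cases2) (simp_all add: const_rat_of_nat const_rat_uminus)

lemma const_rat_inverse_mult: "c \<noteq> 0 \<Longrightarrow> const_rat (inverse c) * const_rat c = 1"
  by (simp flip: const_rat_mult)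

lemma const_rat_eq_0_iff [simp]: "const_rat c = 0 \<longleftrightarrow> c = 0"
  by (metis const_rat_0 const_rat_inverse_mult mult_zero_right zero_neq_one)

text \<open>Characteristic zero of \<complex>(z); it allows cancelling 2 and k! in alternating
  sums.\<close>

lemma of_nat_ratfun_eq_0_iff: "(of_nat n :: 'n::{finite,linorder} ratfun) = 0 \<longleftrightarrow> n = 0"
  by (simp flip: const_rat_of_nat)

lemma permutation_UNIV: "\<tau> permutes (UNIV :: 'a::finite set) \<Longrightarrow> permutation \<tau>"
  by (auto simp: permutation_permutes)

lemma perm_rat_minus:
  assumes "bij \<tau>"
  shows "perm_rat \<tau> (- f) = - perm_rat \<tau> f" "perm_rat \<tau> (f - g) = perm_rat \<tau> f - perm_rat \<tau> g"
proof -
  have "perm_rat \<tau> (- f) + perm_rat \<tau> f = 0" for f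
    using perm_rat_simps(1)[OF assms, of "- f" f] perm_rat_simps(3)[OF assms, of 0] by simp
  then show *: "perm_rat \<tau> (- f) = - perm_rat \<tau> f" for f
    by (simp add: eq_neg_iff_add_eq_0)
  show "perm_rat \<tau> (f - g) = perm_rat \<tau> f - perm_rat \<tau> g"
    using perm_rat_simps(1)[OF assms, of f "- g"] by (simp add: *)
qed

lemma perm_rat_prod:
  assumes "bij \<tau>" shows "perm_rat \<tau> (\<Prod>x\<in>S. f x) = (\<Prod>x\<in>S. perm_rat \<tau> (f x))"
  using perm_rat_simps(3)[OF assms, of 1]
  by (induction S rule: infinite_finite_induct) (simp_all add: perm_rat_simps[OF assms])

lemma perm_rat_sum:
  assumes "bij \<tau>" shows "perm_rat \<tau> (\<Sum>x\<in>S. f x) = (\<Sum>x\<in>S. perm_rat \<tau> (f x))"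
  using perm_rat_simps(3)[OF assms, of 0]
  by (induction S rule: infinite_finite_induct) (simp_all add: perm_rat_simps[OF assms])

lemma perm_rat_power:
  assumes "bij \<tau>" shows "perm_rat \<tau> (f ^ n) = perm_rat \<tau> f ^ n"
  using perm_rat_prod[OF assms, of "\<lambda>_. f" "{..<n}"] by simp

text \<open>A bijection permutes the index sets of size h among themselves, so it only reorders the
  summands of \<open>sigma h\<close>.\<close>

lemma perm_rat_sigma:
  assumes "bij \<tau>" shows "perm_rat \<tau> (sigma h) = sigma h"
proof -
  have inj: "inj \<tau>" using assms by (rule bij_is_inj)
  have "perm_rat \<tau> (sigma h) = (\<Sum>S | S \<subseteq> UNIV \<and> card S = h. \<Prod>i\<in>S. zvar (\<tau> i))"
    by (simp add: sigma_def perm_rat_sum perm_rat_prod perm_rat_simps assms)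
  also have "\<dots> = (\<Sum>S | S \<subseteq> UNIV \<and> card S = h. \<Prod>i\<in>\<tau> ` S. zvar i)"
    using inj by (intro sum.cong refl) (simp add: prod.reindex inj_on_subset[OF inj])
  also have "\<dots> = sigma h"
    unfolding sigma_def
  proof (rule sum.reindex_bij_betw)
    show "bij_betw ((`) \<tau>) {S. S \<subseteq> UNIV \<and> card S = h} {S. S \<subseteq> UNIV \<and> card S = h}"
    proof (rule bij_betw_byWitness[where f' = "(`) (inv \<tau>)"])
      show "\<forall>S\<in>{S. S \<subseteq> UNIV \<and> card S = h}. inv \<tau> ` \<tau> ` S = S"
        using inj by (auto simp: image_inv_f_f)
      show "\<forall>S\<in>{S. S \<subseteq> UNIV \<and> card S = h}. \<tau> ` inv \<tau> ` S = S"
        using assms by (auto simp: image_f_inv_f bij_is_surj)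
      show "(`) \<tau> ` {S. S \<subseteq> UNIV \<and> card S = h} \<subseteq> {S. S \<subseteq> UNIV \<and> card S = h}"
        using inj by (auto simp: card_image inj_on_subset[OF inj])
      show "(`) (inv \<tau>) ` {S. S \<subseteq> UNIV \<and> card S = h} \<subseteq> {S. S \<subseteq> UNIV \<and> card S = h}"
        using bij_is_inj[OF bij_imp_bij_inv[OF assms]]
        by (auto simp: card_image inj_on_subset)
    qed
  qed
  finally show ?thesis .
qed

section \<open>Subalgebras of \<open>\<complex>(z)\<close>\<close>

inductive_set subalg :: "'n::{finite,linorder} ratfun set \<Rightarrow> 'n ratfun set"
  for G :: "'n ratfun set" where
  const: "const_rat c \<in> subalg G"
| gen: "g \<in> G \<Longrightarrow> g \<in> subalg G"
| add: "f \<in> subalg G \<Longrightarrow> g \<in> subalg G \<Longrightarrow> f + g \<in> subalg G"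
| mult: "f \<in> subalg G \<Longrightarrow> g \<in> subalg G \<Longrightarrow> f * g \<in> subalg G"

lemma subalg_0 [simp]: "0 \<in> subalg G" and subalg_1 [simp]: "1 \<in> subalg G"
  using subalg.const[of 0 G] subalg.const[of 1 G] by simp_all

lemma subalg_sum: "(\<And>x. x \<in> S \<Longrightarrow> f x \<in> subalg G) \<Longrightarrow> (\<Sum>x\<in>S. f x) \<in> subalg G"
  by (induction S rule: infinite_finite_induct) (auto intro: subalg.add)

lemma subalg_prod: "(\<And>x. x \<in> S \<Longrightarrow> f x \<in> subalg G) \<Longrightarrow> (\<Prod>x\<in>S. f x) \<in> subalg G"
  by (induction S rule: infinite_finite_induct) (auto intro: subalg.mult)

lemma subalg_power: "f \<in> subalg G \<Longrightarrow> f ^ n \<in> subalg G"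
  by (induction n) (auto intro: subalg.mult)

lemma subalg_uminus: "f \<in> subalg G \<Longrightarrow> - f \<in> subalg G"
  using subalg.mult[OF subalg.const[of "- 1" G], of f] by (simp add: const_rat_uminus)

lemma subalg_diff: "f \<in> subalg G \<Longrightarrow> g \<in> subalg G \<Longrightarrow> f - g \<in> subalg G"
  using subalg.add[OF _ subalg_uminus, of f G g] by simp

text \<open>The polynomial rings \<complex>[z] (\<open>zring\<close>) and \<complex>[\<sigma>]
  (\<open>sring\<close>) inside the field. Describing them by generators permits induction over
  their elements without a normal form for polynomials.\<close>

definition zring :: "'n::{finite,linorder} ratfun set" where
  "zring = subalg (range zvar)"

definition sring :: "'n::{finite,linorder} ratfun set" where
  "sring = subalg (sigma ` {1..CARD('n)})"

lemma sigma_in_zring: "sigma h \<in> zring"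
  unfolding sigma_def zring_def by (intro subalg_sum subalg_prod subalg.gen) auto

lemma sring_subset_zring: "sring \<subseteq> zring"
proof
  fix f :: "'a ratfun" assume "f \<in> sring"
  then show "f \<in> zring" unfolding sring_def
    by induction (use sigma_in_zring in \<open>auto simp: zring_def intro: subalg.intros\<close>)
qed

lemma sigma_0: "sigma 0 = 1"
proof -
  have "{S :: 'n::{finite,linorder} set. S \<subseteq> UNIV \<and> card S = 0} = {{}}" by auto
  then show ?thesis by (simp add: sigma_def)
qed

lemma perm_rat_sring:
  assumes "bij \<tau>" "f \<in> sring" shows "perm_rat \<tau> f = f"
  using assms(2) unfolding sring_def
  by induction (use assms(1) in \<open>auto simp: perm_rat_simps perm_rat_sigma\<close>)

lemma pd_z_zring:
  assumes "f \<in> zring" shows "pd_z i f \<in> zring"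
  using assms unfolding zring_def
proof induction
  case (gen g)
  then obtain j where "g = zvar j" by auto
  then show ?case by (auto simp: pd_z_zvar)
qed (auto simp: derivation_simps[OF derivation_pd_z] intro: subalg.intros)

lemma W1_zring:
  assumes "A \<in> W1" "f \<in> zring" shows "A f \<in> zring"
  using assms unfolding W1_def
proof (induction arbitrary: f rule: op_algebra.induct)
  case (generator P)
  have "zvar i * f \<in> zring" for i
    using generator.prems by (auto simp: zring_def intro: subalg.mult subalg.gen)
  then show ?case
    using generator by (auto simp: mult_op_def pd_z_zring simp flip: zring_def)
qed (auto simp: mult_op_def zring_def intro: subalg.intros)

section \<open>Monomials of bounded degree\<close>

definition zmon :: "('n \<Rightarrow> nat) \<Rightarrow> 'n::{finite,linorder} ratfun" where
  "zmon a = (\<Prod>i\<in>UNIV. zvar i ^ a i)"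

text \<open>The coefficient set \<open>S\<close> is a parameter: it is \<open>sring\<close> when
  \<complex>[z] is expanded over \<complex>[\<sigma>], and \<open>range const_rat\<close> when
  \<delta> is expanded over \<complex>.\<close>

inductive_set mon_span :: "'n::{finite,linorder} ratfun set \<Rightarrow> ('n \<Rightarrow> nat) \<Rightarrow> 'n ratfun set"
  for S :: "'n ratfun set" and d :: "'n \<Rightarrow> nat" where
  mon: "s \<in> S \<Longrightarrow> a \<le> d \<Longrightarrow> s * zmon a \<in> mon_span S d"
| add: "f \<in> mon_span S d \<Longrightarrow> g \<in> mon_span S d \<Longrightarrow> f + g \<in> mon_span S d"

lemma zmon_add: "zmon (\<lambda>i. a i + b i) = zmon a * zmon b"
  by (simp add: zmon_def power_add prod.distrib)

lemma zmon_single: "zmon (\<lambda>i. if i = j then n else 0) = zvar j ^ n"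
proof -
  have "zmon (\<lambda>i. if i = j then n else 0) = (\<Prod>i\<in>UNIV. if i = j then zvar i ^ n else 1)"
    unfolding zmon_def by (intro prod.cong) auto
  then show ?thesis by simp
qed

lemma mon_span_mono: "d \<le> d' \<Longrightarrow> f \<in> mon_span S d \<Longrightarrow> f \<in> mon_span S d'"
  by (rotate_tac, induction rule: mon_span.induct) (auto intro: mon_span.intros order_trans)

lemma mon_span_mult:
  assumes "f \<in> mon_span S d" "\<And>s. s \<in> S \<Longrightarrow> c * s \<in> S"
  shows "c * f \<in> mon_span S d"
  using assms(1)
proof induction
  case (mon s a)
  then have "(c * s) * zmon a \<in> mon_span S d"
    using assms(2) by (intro mon_span.mon)
  then show ?case by (simp add: mult.assoc)
qed (auto simp: distrib_left intro: mon_span.add)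

lemma mon_span_mult_zvar:
  assumes "f \<in> mon_span S d"
  shows "zvar j * f \<in> mon_span S (\<lambda>i. d i + (if i = j then 1 else 0))"
  using assms
proof induction
  case (mon s a)
  have "s * zmon (\<lambda>i. a i + (if i = j then 1 else 0)) \<in> mon_span S (\<lambda>i. d i + (if i = j then 1 else 0))"
    using mon by (intro mon_span.mon) (auto simp: le_fun_def)
  then show ?case by (simp add: zmon_add zmon_single mult_ac)
qed (auto simp: distrib_left intro: mon_span.add)

lemma mon_span_sum:
  assumes "0 \<in> S" "\<And>x. x \<in> X \<Longrightarrow> f x \<in> mon_span S d"
  shows "(\<Sum>x\<in>X. f x) \<in> mon_span S d"
  using assms(2) mon_span.mon[OF assms(1), of "\<lambda>_. 0" d]
  by (induction X rule: infinite_finite_induct) (auto simp: le_fun_def intro: mon_span.add)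

text \<open>The relation \<open>\<Sum>\<^sub>h (-1)\<^sup>h \<sigma>\<^sub>h z\<^sub>j\<^sup>k\<^sup>-\<^sup>h = 0\<close> lowers exponents \<open>\<ge> k\<close>.\<close>

lemma zvar_power_CARD:
  "zvar j ^ CARD('n) = (\<Sum>h\<in>{1..CARD('n)}. ((-1) ^ Suc h * sigma h) * (zvar j :: 'n::{finite,linorder} ratfun) ^ (CARD('n) - h))"
proof -
  have "0 = (\<Sum>h\<le>CARD('n). (-1) ^ h * sigma h * (zvar j :: 'n ratfun) ^ (CARD('n) - h))"
    using poly_zpoly[of j] by (simp add: zpoly_eq poly_sum poly_monom)
  also have "{..CARD('n)} = insert 0 {1..CARD('n)}" by auto
  also have "(\<Sum>h\<in>insert 0 {1..CARD('n)}. (-1) ^ h * sigma h * (zvar j :: 'n ratfun) ^ (CARD('n) - h)) =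
      zvar j ^ CARD('n) + (\<Sum>h\<in>{1..CARD('n)}. (-1) ^ h * sigma h * zvar j ^ (CARD('n) - h))"
    by (subst sum.insert) (auto simp: sigma_0)
  finally show ?thesis
    by (simp add: sum_negf eq_neg_iff_add_eq_0)
qed

text \<open>The span is a \<complex>[\<sigma>]-module containing 1, so it suffices that it is stable
  under multiplication by each \<open>zvar j\<close>. This is clear unless the exponent at j is
  already k - 1, and then the relation for the k-th power applies.\<close>

lemma zring_subset_mon_span:
  "zring \<subseteq> mon_span sring (\<lambda>_ :: 'n::{finite,linorder}. CARD('n) - 1)"
proof
  let ?V = "mon_span sring (\<lambda>_ :: 'n. CARD('n) - 1)"
  have smult: "c * f \<in> ?V" if "c \<in> sring" "f \<in> ?V" for c f
    using that by (auto intro!: mon_span_mult simp: sring_def intro: subalg.mult)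
  have sig: "sigma h \<in> (sring :: 'n ratfun set)" if "h \<in> {1..CARD('n)}" for h
    using that by (auto simp: sring_def intro: subalg.gen)
  have var: "zvar j * f \<in> ?V" if "f \<in> ?V" for f j
    using that
  proof induction
    case (mon s a)
    have *: "zvar j * zmon a \<in> ?V"
    proof (cases "a j + 1 < CARD('n)")
      case True
      have "1 * zmon (\<lambda>i. a i + (if i = j then 1 else 0)) \<in> ?V"
        using mon True by (intro mon_span.mon) (auto simp: le_fun_def sring_def)
      then show ?thesis by (simp add: zmon_add zmon_single mult_ac)
    next
      case False
      moreover have "a j \<le> CARD('n) - 1" using mon(2) by (simp add: le_fun_def)
      ultimately have aj: "a j + 1 = CARD('n)"
        using zero_less_card_finite[where 'a='n] by linarith
      \<comment> \<open>The power of \<open>zvar j\<close> is split off from the monomial, so that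
        the extra factor completes it to the k-th power, which can be rewritten.\<close>
      define b where "b = a(j := 0)"
      have "zmon a = zmon (\<lambda>i. b i + (if i = j then a j else 0))"
        by (intro arg_cong[of _ _ zmon]) (auto simp: b_def)
      then have "zvar j * zmon a = zvar j ^ CARD('n) * zmon b"
        by (simp add: zmon_add zmon_single flip: aj)
      also have "\<dots> = (\<Sum>h\<in>{1..CARD('n)}. ((-1) ^ Suc h * sigma h) *
          zmon (\<lambda>i. b i + (if i = j then CARD('n) - h else 0)))"
        unfolding zvar_power_CARD sum_distrib_right
        by (intro sum.cong refl) (simp add: zmon_add zmon_single)
      also have "\<dots> \<in> ?V"
      proof (intro mon_span_sum mon_span.mon)
        fix h assume h: "h \<in> {1..CARD('n)}"
        have "(-1) ^ Suc h \<in> (sring :: 'n ratfun set)"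
          unfolding sring_def by (intro subalg_power subalg_uminus) simp
        then show "(-1) ^ Suc h * sigma h \<in> (sring :: 'n ratfun set)"
          using sig[OF h] unfolding sring_def by (rule subalg.mult)
        show "(\<lambda>i. b i + (if i = j then CARD('n) - h else 0)) \<le> (\<lambda>_. CARD('n) - 1)"
          using mon(2) h by (auto simp: le_fun_def b_def)
      qed (simp add: sring_def)
      finally show ?thesis .
    qed
    then show ?case
      using smult[OF mon(1) *] by (simp add: mult_ac)
  qed (auto simp: distrib_left intro: mon_span.add)
  fix f :: "'n ratfun" assume "f \<in> zring"
  \<comment> \<open>Taking any g in the span, not only 1, lets a product in \<open>zring\<close> be
    treated by two successive multiplications.\<close>
  then have "f * g \<in> ?V" if "g \<in> ?V" for g
    using that unfolding zring_def
  proof (induction arbitrary: g)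
    case (const c)
    then show ?case by (intro smult) (auto simp: sring_def intro: subalg.const)
  next
    case (gen h)
    then show ?case using var by auto
  qed (auto simp: distrib_right mult.assoc intro: mon_span.add)
  moreover have "1 * zmon (\<lambda>_. 0) \<in> ?V"
    by (intro mon_span.mon) (auto simp: sring_def le_fun_def)
  ultimately have "f * (1 * zmon (\<lambda>_. 0)) \<in> ?V" by blast
  then show "f \<in> ?V" by (simp add: zmon_def)
qed

section \<open>Alternating sums\<close>

text \<open>Anti-symmetrization without the normalizing factor 1/k!.\<close>

definition alt :: "'n::{finite,linorder} ratfun \<Rightarrow> 'n ratfun" where
  "alt f = (\<Sum>\<tau> | \<tau> permutes UNIV. of_int (sign \<tau>) * perm_rat \<tau> f)"

lemma alt_add: "alt (f + g) = alt f + alt g"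
  unfolding alt_def sum.distrib[symmetric]
  by (intro sum.cong refl) (simp add: perm_rat_simps permutes_bij distrib_left)

lemma alt_mult_sring: "s \<in> sring \<Longrightarrow> alt (s * f) = s * alt f"
  unfolding alt_def sum_distrib_left
  by (intro sum.cong refl) (simp add: perm_rat_simps perm_rat_sring permutes_bij mult_ac)

lemma alt_antisymmetric:
  fixes f :: "'n::{finite,linorder} ratfun"
  assumes "\<And>\<tau>. \<tau> permutes UNIV \<Longrightarrow> perm_rat \<tau> f = of_int (sign \<tau>) * f"
  shows "alt f = of_nat (fact CARD('n)) * f"
proof -
  have "alt f = (\<Sum>\<tau> | \<tau> permutes (UNIV :: 'n set). f)"
    unfolding alt_def
    by (intro sum.cong refl) (simp add: assms flip: mult.assoc of_int_mult)
  also have "\<dots> = of_nat (fact CARD('n)) * f"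
    by (simp add: card_permutations[where S = "UNIV :: 'n set"])
  finally show ?thesis .
qed

text \<open>Composing with \<rho> on the right permutes the indices \<tau> of the sum and multiplies
  every sign by \<open>sign \<rho>\<close>.\<close>

lemma alt_perm_rat:
  assumes "\<rho> permutes UNIV"
  shows "alt (perm_rat \<rho> f) = of_int (sign \<rho>) * alt f"
proof -
  have *: "of_int (sign \<tau>) * perm_rat \<tau> (perm_rat \<rho> f) =
      of_int (sign \<rho>) * (of_int (sign (\<tau> \<circ> \<rho>)) * perm_rat (\<tau> \<circ> \<rho>) f)" if "\<tau> permutes UNIV" for \<tau>
  proof -
    have "sign \<rho> * sign (\<tau> \<circ> \<rho>) = sign \<tau>"
      using that assms by (simp add: sign_compose permutation_UNIV)
    then have "(of_int (sign \<tau>) :: 'a ratfun) = of_int (sign \<rho>) * of_int (sign (\<tau> \<circ> \<rho>))"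
      by (metis of_int_mult)
    then show ?thesis
      using that assms by (simp add: perm_rat_comp permutes_bij mult.assoc)
  qed
  have "alt (perm_rat \<rho> f) =
      (\<Sum>\<tau> | \<tau> permutes UNIV. of_int (sign \<rho>) * (of_int (sign (\<tau> \<circ> \<rho>)) * perm_rat (\<tau> \<circ> \<rho>) f))"
    unfolding alt_def by (intro sum.cong refl) (simp only: mem_Collect_eq *)
  also have "\<dots> = of_int (sign \<rho>) * alt f"
    unfolding alt_def sum_distrib_left[symmetric]
    by (subst sum_permutations_compose_right[OF assms]) simp
  finally show ?thesis .
qed

lemma perm_rat_zmon:
  assumes "\<tau> permutes UNIV" shows "perm_rat \<tau> (zmon (a \<circ> \<tau>)) = zmon a"
proof -
  have "perm_rat \<tau> (zmon (a \<circ> \<tau>)) = (\<Prod>i\<in>UNIV. zvar (\<tau> i) ^ a (\<tau> i))"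
    using assms by (simp add: zmon_def perm_rat_prod perm_rat_power perm_rat_simps permutes_bij)
  also have "\<dots> = zmon a"
    unfolding zmon_def
    using prod.reindex_bij_betw[OF permutes_bij[OF assms], of "\<lambda>i. zvar i ^ a i"] by simp
  finally show ?thesis .
qed

lemma alt_zmon_permute:
  assumes "\<tau> permutes UNIV" shows "alt (zmon a) = of_int (sign \<tau>) * alt (zmon (a \<circ> \<tau>))"
  using alt_perm_rat[OF assms, of "zmon (a \<circ> \<tau>)"] by (simp add: perm_rat_zmon[OF assms])

text \<open>The transposition of two indices with equal exponents fixes the monomial and has sign
  -1, so the alternating sum equals its own negative.\<close>

lemma alt_zmon_eq_0:
  fixes a :: "'n::{finite,linorder} \<Rightarrow> nat"
  assumes "\<not> inj a" shows "alt (zmon a) = 0"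
proof -
  obtain i j where ij: "i \<noteq> j" "a i = a j" using assms by (auto simp: inj_def)
  let ?t = "transpose i j"
  have "a \<circ> ?t = a" using ij by (auto simp: fun_eq_iff transpose_def)
  moreover have "?t permutes UNIV" by (rule permutes_swap_id) auto
  ultimately have "alt (zmon a) = of_int (sign ?t) * alt (zmon a)"
    using alt_zmon_permute[of ?t a] by metis
  also have "\<dots> = - alt (zmon a)" using ij by (simp add: sign_swap_id)
  finally have "alt (zmon a) + alt (zmon a) = 0"
    by (rule eq_neg_iff_add_eq_0[THEN iffD1])
  moreover have "of_nat 2 * alt (zmon a) = alt (zmon a) + alt (zmon a)"
    by (simp only: of_nat_numeral mult_2)
  ultimately have "of_nat 2 * alt (zmon a) = 0" by (rule trans[rotated])
  then show ?thesis by (simp only: mult_eq_0_iff of_nat_ratfun_eq_0_iff) simp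
qed

text \<open>An injective exponent vector bounded by k - 1 takes each of the values 0, ..., k - 1
  exactly once, so two such vectors differ by a permutation of the indices.\<close>

lemma alt_zmon_inj:
  fixes a b :: "'n::{finite,linorder} \<Rightarrow> nat"
  assumes "inj a" "a \<le> (\<lambda>_. CARD('n) - 1)" "inj b" "b \<le> (\<lambda>_. CARD('n) - 1)"
  obtains \<tau> :: "'n \<Rightarrow> 'n" where "\<tau> permutes UNIV" "alt (zmon a) = of_int (sign \<tau>) * alt (zmon b)"
proof -
  have range: "range c = {..<CARD('n)}" if "inj c" "c \<le> (\<lambda>_. CARD('n) - 1)" for c :: "'n \<Rightarrow> nat"
  proof (rule card_subset_eq)
    show "range c \<subseteq> {..<CARD('n)}"
    proof clarsimp
      fix i show "c i < CARD('n)"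
        using that(2)[THEN le_funD, of i] zero_less_card_finite[where 'a='n] by linarith
    qed
  qed (simp_all add: card_image that)
  define \<tau> where "\<tau> = inv a \<circ> b"
  have r: "range a = range b" using range assms by simp
  have a: "a \<circ> \<tau> = b"
  proof
    fix i
    have "b i \<in> range a" using r by auto
    then show "(a \<circ> \<tau>) i = b i" by (simp add: \<tau>_def f_inv_into_f)
  qed
  have "inj \<tau>"
    using assms(3) unfolding a[symmetric] by (rule inj_on_imageI2)
  then have "\<tau> permutes UNIV"
    by (intro bij_imp_permutes) (auto simp: bij_def finite_UNIV_inj_surj)
  then show ?thesis
    using that alt_zmon_permute[of \<tau> a] by (simp add: a)
qed

section \<open>The Vandermonde product: sign under permutations and expansion into monomials\<close>

lemma delta_neq_0: "delta \<noteq> (0 :: 'n::{finite,linorder} ratfun)"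
proof -
  have "finite {(i, j :: 'n). i < j}" by simp
  then show ?thesis
    by (auto simp: delta_def prod_zero_iff inj_eq[OF inj_zvar])
qed

text \<open>The excluded pairs (i, j) are exactly the inversions of \<open>transpose a b\<close>;
  this locates the sign changes among the factors of \<delta>.\<close>

lemma transpose_less:
  fixes a b :: "'a::linorder"
  assumes "a < b" "i < j" "(i, j) \<noteq> (a, b)" "\<not> (i = a \<and> a < j \<and> j < b)" "\<not> (j = b \<and> a < i \<and> i < b)"
  shows "transpose a b i < transpose a b j"
  using assms
  by (cases "i = a"; cases "j = b"; cases "i = b"; cases "j = a"; simp add: transpose_def not_less; order)

text \<open>
  The transposition of \<open>a < b\<close> inverts the pair \<open>(a, b)\<close>, and the other pairs which it inverts are
  \<open>(a, c)\<close> and \<open>(c, b)\<close> with \<open>a < c < b\<close>; these come in twos.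
\<close>

lemma perm_rat_delta_transpose:
  fixes a b :: "'n::{finite,linorder}"
  assumes "a < b"
  shows "perm_rat (transpose a b) delta = - delta"
proof -
  let ?t = "transpose a b"
  have bij: "bij ?t" by simp
  define Y where "Y = {(i, j :: 'n). i < j} - {(a, b)}"
  \<comment> \<open>\<open>\<phi>\<close> moves a pair by the transposition and sorts it again;
    \<open>\<epsilon>\<close> records the sign which the sorting costs. \<open>B\<close> collects
    the inverted pairs other than (a, b).\<close>
  define \<phi> where "\<phi> = (\<lambda>(i, j). if ?t i < ?t j then (?t i, ?t j) else (?t j, ?t i))"
  define \<epsilon> :: "'n \<times> 'n \<Rightarrow> 'n ratfun" where "\<epsilon> = (\<lambda>(i, j). if ?t i < ?t j then 1 else - 1)"
  define F :: "'n \<times> 'n \<Rightarrow> 'n ratfun" where "F = (\<lambda>(i, j). zvar i - zvar j)"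
  define B where "B = {a} \<times> {a<..<b} \<union> {a<..<b} \<times> {b}"
  have delta: "delta = F (a, b) * prod F Y"
  proof -
    have "{(i, j :: 'n). i < j} = insert (a, b) Y" "(a, b) \<notin> Y"
      using assms by (auto simp: Y_def)
    moreover have "finite Y" by simp
    ultimately show ?thesis
      unfolding delta_def F_def[symmetric] by simp
  qed
  have inj: "?t i = ?t j \<longleftrightarrow> i = j" for i j by (rule inj_eq) simp
  have tab: "?t i = a \<longleftrightarrow> i = b" "?t i = b \<longleftrightarrow> i = a" for i
    by (auto simp: transpose_def)
  have \<phi>Y: "\<phi> x \<in> Y \<and> \<phi> (\<phi> x) = x" if "x \<in> Y" for x
  proof -
    obtain i j where x: "x = (i, j)" by (cases x)
    have ij: "i < j" "(i, j) \<noteq> (a, b)" using that by (auto simp: Y_def x)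
    show ?thesis
    proof (cases "?t i < ?t j")
      case True
      have "\<not> (?t i = a \<and> ?t j = b)"
        unfolding tab using ij(1) assms by auto
      then show ?thesis using True ij by (simp add: x \<phi>_def Y_def)
    next
      case False
      then have "?t j < ?t i" using inj[of i j] ij(1) by (metis less_irrefl linorder_neqE)
      moreover have "\<not> (?t j = a \<and> ?t i = b)"
        unfolding tab using ij(2) by auto
      moreover have "\<not> j < i" using ij(1) by simp
      ultimately show ?thesis using ij(1) False by (simp add: x \<phi>_def Y_def)
    qed
  qed
  have \<phi>: "bij_betw \<phi> Y Y"
    by (rule bij_betw_byWitness[where f' = \<phi>]) (use \<phi>Y in auto)
  have F: "perm_rat ?t (F x) = \<epsilon> x * F (\<phi> x)" for x
    by (cases x) (simp add: F_def \<epsilon>_def \<phi>_def perm_rat_minus perm_rat_simps bij)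
  have "(\<Prod>x\<in>Y. \<epsilon> x) = (\<Prod>x\<in>B. - 1)"
  proof (rule prod.mono_neutral_cong_right)
    show "B \<subseteq> Y" using assms by (auto simp: B_def Y_def)
    show "\<forall>x\<in>Y - B. \<epsilon> x = 1"
    proof
      fix x assume x: "x \<in> Y - B"
      then have "?t (fst x) < ?t (snd x)"
        by (intro transpose_less[OF assms]) (auto simp: B_def Y_def)
      then show "\<epsilon> x = 1" by (simp add: \<epsilon>_def case_prod_beta)
    qed
    show "\<epsilon> x = - 1" if "x \<in> B" for x
    proof -
      have "?t (snd x) < ?t (fst x)"
        using that assms by (auto simp: B_def transpose_def)
      then show ?thesis by (simp add: \<epsilon>_def case_prod_beta)
    qed
  qed simp
  also have "\<dots> = (- 1) ^ (2 * card {a<..<b})"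
  proof -
    have "card B = card ({a} \<times> {a<..<b}) + card ({a<..<b} \<times> {b})"
      unfolding B_def by (rule card_Un_disjoint) auto
    then show ?thesis by (simp add: card_cartesian_product)
  qed
  also have "\<dots> = 1" by simp
  finally have \<epsilon>: "(\<Prod>x\<in>Y. \<epsilon> x) = 1" .
  have "perm_rat ?t delta = perm_rat ?t (F (a, b)) * (\<Prod>x\<in>Y. perm_rat ?t (F x))"
    by (simp only: delta perm_rat_simps(2)[OF bij] perm_rat_prod[OF bij])
  also have "perm_rat ?t (F (a, b)) = - F (a, b)"
    by (simp add: F_def perm_rat_minus perm_rat_simps bij)
  also have "(\<Prod>x\<in>Y. perm_rat ?t (F x)) = prod F Y"
    using prod.reindex_bij_betw[OF \<phi>, of F] by (simp add: F prod.distrib \<epsilon>)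
  finally show ?thesis by (simp only: delta mult_minus_left)
qed

text \<open>Every permutation is built from the identity by transpositions, and each of these
  reverses both \<delta> and the sign of the permutation.\<close>

lemma perm_rat_delta:
  assumes "\<tau> permutes (UNIV :: 'n::{finite,linorder} set)"
  shows "perm_rat \<tau> delta = of_int (sign \<tau>) * delta"
  using assms finite
proof (induction rule: permutes_induct)
  case id
  show ?case using perm_rat_id[of delta] by (simp add: id_def)
next
  case (swap a b p)
  have t: "perm_rat (transpose a b) delta = - delta"
  proof (cases "a < b")
    case False
    with swap have "b < a" by simp
    then show ?thesis
      using perm_rat_delta_transpose[of b a] by (simp add: transpose_commute)
  qed (rule perm_rat_delta_transpose)
  have bij: "bij (transpose a b)" "bij p" using swap by (simp_all add: permutes_bij)
  have "perm_rat (transpose a b \<circ> p) delta = perm_rat (transpose a b) (const_rat (of_int (sign p)) * delta)"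
    using swap.IH by (simp only: perm_rat_comp[OF bij, symmetric] const_rat_of_int)
  also have "\<dots> = - of_int (sign p) * delta"
    by (simp only: perm_rat_simps(2,3)[OF bij(1)] t) (simp add: const_rat_of_int)
  also have "- (of_int (sign p) :: 'n ratfun) = of_int (sign (transpose a b \<circ> p))"
    using swap by (simp add: sign_compose sign_swap_id permutation_UNIV permutation_swap_id)
  finally show ?case .
qed

text \<open>When the product is multiplied out, each factor contributes one of its two variables, so
  the exponent at l is at most the number of pairs containing l.\<close>

lemma prod_diff_in_mon_span:
  fixes X :: "('n::{finite,linorder} \<times> 'n) set"
  assumes "\<And>i. (i, i) \<notin> X"
  shows "(\<Prod>(i, j)\<in>X. zvar i - zvar j) \<in>
    mon_span (range const_rat) (\<lambda>l. card {(i, j) \<in> X. i = l \<or> j = l})"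
proof -
  have "finite X" by simp
  then show ?thesis using assms
  proof (induction X rule: finite_induct)
    case empty
    have "const_rat 1 * zmon (\<lambda>_. 0) \<in> mon_span (range const_rat) (\<lambda>_ :: 'n. 0)"
      by (rule mon_span.mon[OF rangeI]) simp
    then show ?case by (simp add: zmon_def)
  next
    case (insert x X)
    obtain p q where x: "x = (p, q)" by (cases x)
    have pq: "p \<noteq> q" using insert.prems[of p] x by auto
    let ?d = "\<lambda>l. card {(i, j) \<in> X. i = l \<or> j = l}"
    let ?d' = "\<lambda>l. card {(i, j) \<in> insert x X. i = l \<or> j = l}"
    let ?f = "\<Prod>(i, j)\<in>X. zvar i - zvar j :: 'n ratfun"
    have f: "?f \<in> mon_span (range const_rat) ?d"
      using insert by auto
    have d': "?d' l = ?d l + (if l = p \<or> l = q then 1 else 0)" for l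
    proof -
      have "{(i, j) \<in> insert x X. i = l \<or> j = l} =
          (if l = p \<or> l = q then insert x {(i, j) \<in> X. i = l \<or> j = l} else {(i, j) \<in> X. i = l \<or> j = l})"
        by (auto simp: x)
      moreover have "x \<notin> {(i, j) \<in> X. i = l \<or> j = l}" using insert.hyps by auto
      ultimately show ?thesis by simp
    qed
    have neg: "const_rat (- 1) * g \<in> mon_span (range const_rat) d"
      if "g \<in> mon_span (range const_rat) d" for g :: "'n ratfun" and d
      using that by (rule mon_span_mult) (auto simp flip: const_rat_mult)
    have "zvar p * ?f \<in> mon_span (range const_rat) ?d'"
      by (rule mon_span_mono[OF _ mon_span_mult_zvar[OF f]]) (simp only: le_fun_def d', simp)
    \<comment> \<open>The rules of \<open>mon_span\<close> offer only addition, so the minus sign is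
      absorbed into the constant coefficients.\<close>
    moreover have "const_rat (- 1) * (zvar q * ?f) \<in> mon_span (range const_rat) ?d'"
      by (rule neg, rule mon_span_mono[OF _ mon_span_mult_zvar[OF f]]) (simp only: le_fun_def d', simp)
    ultimately have "zvar p * ?f + const_rat (- 1) * (zvar q * ?f) \<in> mon_span (range const_rat) ?d'"
      by (rule mon_span.add)
    then show ?case
      using insert.hyps by (simp add: x const_rat_uminus algebra_simps)
  qed
qed

text \<open>The pairs i < j which contain a given index l are determined by their other entry, so
  there are at most k - 1 of them.\<close>

lemma delta_in_mon_span:
  "delta \<in> mon_span (range const_rat) (\<lambda>_ :: 'n::{finite,linorder}. CARD('n) - 1)"
  unfolding delta_def
proof (rule mon_span_mono[OF _ prod_diff_in_mon_span])
  let ?X = "{(i, j :: 'n). i < j}"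
  have "card {(i, j) \<in> ?X. i = l \<or> j = l} \<le> card (UNIV - {l})" for l
  proof (rule card_inj_on_le)
    show "inj_on (\<lambda>(i, j). if i = l then j else i) {(i, j) \<in> ?X. i = l \<or> j = l}"
      by (auto simp: inj_on_def split: if_splits)
  qed auto
  then show "(\<lambda>l. card {(i, j) \<in> ?X. i = l \<or> j = l}) \<le> (\<lambda>_. CARD('n) - 1)"
    by (simp add: le_fun_def)
qed auto

text \<open>
  Alternating the expansion of \<open>\<delta>\<close> into monomials with exponents \<open>< k\<close>, only multiples of the single
  alternating sum \<open>alt (zmon a)\<close> survive; as \<open>alt \<delta> = k! \<delta> \<noteq> 0\<close>, this gives the Vandermonde identity
  up to a constant.
\<close>

lemma alt_zmon_delta:
  fixes a :: "'n::{finite,linorder} \<Rightarrow> nat"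
  assumes "a \<le> (\<lambda>_. CARD('n) - 1)"
  shows "\<exists>c. alt (zmon a) = const_rat c * delta"
proof (cases "inj a")
  case False
  then show ?thesis
    by (intro exI[of _ 0]) (simp add: alt_zmon_eq_0)
next
  case inj: True
  have "\<exists>c. alt f = const_rat c * alt (zmon a)"
    if "f \<in> mon_span (range const_rat) (\<lambda>_ :: 'n. CARD('n) - 1)" for f
    using that
  proof induction
    case (mon s b)
    then obtain c where s: "s = const_rat c" by auto
    have eq: "alt (s * zmon b) = s * alt (zmon b)"
      by (rule alt_mult_sring) (simp add: s sring_def subalg.const)
    show ?case
    proof (cases "inj b")
      case True
      then obtain \<tau> :: "'n \<Rightarrow> 'n" where "alt (zmon b) = of_int (sign \<tau>) * alt (zmon a)"
        using alt_zmon_inj[OF _ mon(2) inj assms] by blast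
      then have "alt (s * zmon b) = const_rat (c * of_int (sign \<tau>)) * alt (zmon a)"
        unfolding eq by (simp add: s const_rat_mult const_rat_of_int mult.assoc)
      then show ?thesis ..
    next
      case False
      then show ?thesis
        by (intro exI[of _ 0]) (simp add: eq alt_zmon_eq_0)
    qed
  next
    case (add f g)
    then obtain c d where "alt f = const_rat c * alt (zmon a)" "alt g = const_rat d * alt (zmon a)"
      by blast
    then have "alt (f + g) = const_rat (c + d) * alt (zmon a)"
      by (simp add: alt_add const_rat_add distrib_right)
    then show ?case ..
  qed
  from this[OF delta_in_mon_span] obtain c where c: "alt (delta :: 'n ratfun) = const_rat c * alt (zmon a)"
    by blast
  have ad: "alt (delta :: 'n ratfun) = of_nat (fact CARD('n)) * delta"
    by (rule alt_antisymmetric) (rule perm_rat_delta)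
  moreover have "\<dots> \<noteq> 0"
    by (simp only: mult_eq_0_iff of_nat_ratfun_eq_0_iff) (simp add: delta_neq_0)
  ultimately have "c \<noteq> 0" using c by auto
  then have "alt (zmon a) = const_rat (inverse c) * (const_rat c * alt (zmon a))"
    by (simp add: const_rat_inverse_mult flip: mult.assoc)
  also have "const_rat c * alt (zmon a) = const_rat (of_nat (fact CARD('n))) * delta"
    using c ad by (simp only: const_rat_of_nat)
  also have "const_rat (inverse c) * \<dots> = const_rat (inverse c * of_nat (fact CARD('n))) * delta"
    by (simp only: const_rat_mult mult.assoc)
  finally show ?thesis ..
qed

text \<open>By anti-symmetry, \<open>f\<close> is \<open>alt f\<close> divided by k!. On a spanning
  element \<open>s * zmon a\<close> with \<open>s\<close> in \<complex>[\<sigma>], the alternating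
  sum is \<open>s\<close> times a constant multiple of \<delta>.\<close>

lemma antisymmetric_zring:
  fixes f :: "'n::{finite,linorder} ratfun"
  assumes "f \<in> zring" "\<And>\<tau>. \<tau> permutes UNIV \<Longrightarrow> perm_rat \<tau> f = of_int (sign \<tau>) * f"
  shows "inverse delta * f \<in> sring"
proof -
  have "inverse delta * alt g \<in> sring"
    if "g \<in> mon_span sring (\<lambda>_ :: 'n. CARD('n) - 1)" for g
    using that
  proof induction
    case (mon s a)
    then obtain c where "alt (zmon a) = const_rat c * delta"
      using alt_zmon_delta by blast
    then have "inverse delta * alt (s * zmon a) = s * const_rat c"
      using mon by (simp add: alt_mult_sring delta_neq_0 field_simps)
    then show ?case
      using mon by (auto simp: sring_def intro: subalg.intros)
  qed (auto simp: alt_add distrib_left sring_def intro: subalg.add)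
  then have *: "inverse delta * alt f \<in> sring"
    using assms(1) zring_subset_mon_span by blast
  have "f = const_rat (inverse (fact CARD('n))) * of_nat (fact CARD('n)) * f"
    using const_rat_inverse_mult[of "of_nat (fact CARD('n))", where ?'a = 'n] by (simp only: const_rat_of_nat) simp
  also have "\<dots> = const_rat (inverse (fact CARD('n))) * alt f"
    by (simp only: mult.assoc alt_antisymmetric[OF assms(2)])
  finally have "inverse delta * f = const_rat (inverse (fact CARD('n))) * (inverse delta * alt f)"
    by (simp only: mult.left_commute)
  also have "\<dots> \<in> sring"
    using * unfolding sring_def by (rule subalg.mult[OF subalg.const])
  finally show ?thesis .
qed

section \<open>Operators as combinations of monomials in the \<open>\<partial>\<^sub>h\<close>\<close>

lemma pd_sigma:
  assumes "h \<in> {1..CARD('n::{finite,linorder})}"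
  shows derivation_pd_sigma: "derivation (pd_sigma h :: 'n ratop)"
    and pd_sigma_sigma:
      "j \<in> {1..CARD('n)} \<Longrightarrow> pd_sigma h (sigma j :: 'n ratfun) = (if j = h then 1 else 0)"
  using theI'[OF ex1_pd_sigma[OF assms]] unfolding pd_sigma_def by blast+

text \<open>By \<open>derivation_zpoly\<close>, the values at the \<open>sigma j\<close> determine
  \<open>D (zvar i)\<close>, because the derivative of \<open>zpoly\<close> does not vanish at
  \<open>zvar i\<close>.\<close>

lemma derivation_eqI_sigma:
  fixes D E :: "'n::{finite,linorder} ratop"
  assumes D: "derivation D" and E: "derivation E"
    and eq: "\<And>j. j \<in> {1..CARD('n)} \<Longrightarrow> D (sigma j) = E (sigma j)"
  shows "D = E"
proof (rule derivation_eqI[OF D E])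
  fix i
  have "(\<Sum>j\<in>{1..CARD('n)}. (-1) ^ j * D (sigma j) * zvar i ^ (CARD('n) - j)) =
      (\<Sum>j\<in>{1..CARD('n)}. (-1) ^ j * E (sigma j) * zvar i ^ (CARD('n) - j))"
    by (intro sum.cong) (simp_all add: eq)
  then have "poly (pderiv zpoly) (zvar i) * D (zvar i) = poly (pderiv zpoly) (zvar i) * E (zvar i)"
    using derivation_zpoly[OF D, of i] derivation_zpoly[OF E, of i] by (simp only: add_eq_0_iff)
  then show "D (zvar i) = E (zvar i)"
    by (simp add: pderiv_zpoly_neq_0)
qed

lemma derivation_combination:
  assumes "\<And>x. x \<in> X \<Longrightarrow> derivation (D x)"
  shows "derivation (\<lambda>f. \<Sum>x\<in>X. c x * D x f)"
  unfolding derivation_def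
proof (intro conjI allI)
  note simps = derivation_simps[OF assms]
  show "(\<Sum>x\<in>X. c x * D x (f + g)) = (\<Sum>x\<in>X. c x * D x f) + (\<Sum>x\<in>X. c x * D x g)" for f g
    unfolding sum.distrib[symmetric] by (intro sum.cong refl) (simp add: simps distrib_left)
  show "(\<Sum>x\<in>X. c x * D x (f * g)) = (\<Sum>x\<in>X. c x * D x f) * g + f * (\<Sum>x\<in>X. c x * D x g)" for f g
    unfolding sum_distrib_right sum_distrib_left sum.distrib[symmetric]
    by (intro sum.cong refl) (simp add: simps algebra_simps)
  show "(\<Sum>x\<in>X. c x * D x (const_rat a)) = 0" for a
    by (intro sum.neutral) (simp add: simps)
qed

text \<open>The commutator of two derivations is a derivation, and this one vanishes at each
  \<open>sigma j\<close>, since both operators map \<open>sigma j\<close> to a constant.\<close>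

lemma pd_sigma_commute:
  assumes "h \<in> {1..CARD('n::{finite,linorder})}" "l \<in> {1..CARD('n)}"
  shows "pd_sigma h \<circ> pd_sigma l = (pd_sigma l \<circ> pd_sigma h :: 'n ratop)"
proof -
  note simps = derivation_simps[OF derivation_pd_sigma[OF assms(1)]]
    derivation_simps[OF derivation_pd_sigma[OF assms(2)]]
  have "(\<lambda>f. pd_sigma h (pd_sigma l f) - pd_sigma l (pd_sigma h f)) = (\<lambda>f :: 'n ratfun. 0)"
  proof (rule derivation_eqI_sigma)
    show "derivation (\<lambda>f :: 'n ratfun. pd_sigma h (pd_sigma l f) - pd_sigma l (pd_sigma h f))"
      by (simp add: derivation_def simps algebra_simps)
    show "derivation (\<lambda>f :: 'n ratfun. 0)"
      by (simp add: derivation_def)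
  qed (use assms in \<open>simp add: pd_sigma_sigma simps\<close>)
  then show ?thesis by (simp add: fun_eq_iff)
qed

lemma pd_sigma_sring:
  assumes h: "h \<in> {1..CARD('n::{finite,linorder})}" and f: "f \<in> (sring :: 'n ratfun set)"
  shows "pd_sigma h f \<in> sring"
  using f unfolding sring_def
proof induction
  case (gen g)
  then show ?case using h by (auto simp: pd_sigma_sigma)
qed (auto simp: derivation_simps[OF derivation_pd_sigma[OF h]] intro: subalg.intros)

text \<open>The monomial \<partial>^M, with M the multiset of its indices. Sorting merely fixes an
  order of composition; by commutation any other order gives the same operator if the indices lie in
  {1..k}.\<close>

definition dmon :: "nat multiset \<Rightarrow> 'n::{finite,linorder} ratop" where
  "dmon M = fold pd_sigma (sorted_list_of_multiset M)"

lemma dmon_empty [simp]: "dmon {#} = id"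
  by (simp add: dmon_def)

text \<open>The derivations commute, so the sorted order may be exchanged for one that applies
  \<open>pd_sigma h\<close> last.\<close>

lemma dmon_add:
  assumes "h \<in> {1..CARD('n::{finite,linorder})}" "set_mset M \<subseteq> {1..CARD('n)}"
  shows "dmon (add_mset h M) = (pd_sigma h \<circ> dmon M :: 'n ratop)"
proof -
  have "fold pd_sigma (sorted_list_of_multiset (add_mset h M)) =
      (fold pd_sigma (sorted_list_of_multiset M @ [h]) :: 'n ratop)"
  proof (rule fold_multiset_equiv)
    fix x y assume "x \<in> set (sorted_list_of_multiset (add_mset h M))"
      "y \<in> set (sorted_list_of_multiset (add_mset h M))"
    then have "x \<in> {1..CARD('n)}" "y \<in> {1..CARD('n)}"
      using assms unfolding set_sorted_list_of_multiset by auto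
    then show "pd_sigma x \<circ> pd_sigma y = (pd_sigma y \<circ> pd_sigma x :: 'n ratop)"
      by (rule pd_sigma_commute)
  qed simp
  then show ?thesis by (simp add: dmon_def)
qed

lemma fold_pd_sigma_const_mult:
  assumes "set xs \<subseteq> {1..CARD('n::{finite,linorder})}"
  shows "fold pd_sigma xs (const_rat c * f) = const_rat c * (fold pd_sigma xs f :: 'n ratfun)"
  using assms
proof (induction xs arbitrary: f)
  case (Cons h xs)
  then have "derivation (pd_sigma h :: 'n ratop)" by (simp add: derivation_pd_sigma)
  then show ?case using Cons by (simp add: derivation_simps)
qed simp

text \<open>The Leibniz rule in multiset form; if h does not occur in M, the factor
  \<open>count M h\<close> makes the right-hand side 0.\<close>

lemma pd_sigma_prod_sigma:
  assumes h: "h \<in> {1..CARD('n::{finite,linorder})}" and M: "set_mset M \<subseteq> {1..CARD('n)}"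
  shows "pd_sigma h (\<Prod>j\<in>#M. sigma j :: 'n ratfun) =
    of_nat (count M h) * (\<Prod>j\<in>#M - {#h#}. sigma j)"
  using M
proof (induction M)
  case empty
  then show ?case by (simp add: derivation_simps[OF derivation_pd_sigma[OF h]])
next
  case (add x M)
  note D = derivation_simps[OF derivation_pd_sigma[OF h]]
  show ?case
  proof (cases "x = h")
    case True
    have "sigma h * (of_nat (count M h) * (\<Prod>j\<in>#M - {#h#}. sigma j)) =
        of_nat (count M h) * (\<Prod>j\<in>#M. sigma j :: 'n ratfun)"
    proof (cases "h \<in># M")
      case True
      then have "(\<Prod>j\<in>#M. sigma j) = sigma h * (\<Prod>j\<in>#M - {#h#}. sigma j :: 'n ratfun)"
        by (metis image_mset_add_mset insert_DiffM prod_mset.insert)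
      then show ?thesis by (simp add: mult_ac)
    qed (simp add: not_in_iff)
    then show ?thesis
      using add True h by (simp add: D pd_sigma_sigma algebra_simps)
  next
    case False
    then show ?thesis
      using add h by (simp add: D pd_sigma_sigma mult_ac)
  qed
qed

text \<open>Each \<open>pd_sigma h\<close> removes one factor \<open>sigma h\<close> or gives 0.
  With at least as many derivatives as factors, a nonzero result requires an exact match, and then
  the multiplicities met on the way multiply to \<open>m\<close>.\<close>

lemma fold_pd_sigma_prod_sigma:
  assumes "set xs \<subseteq> {1..CARD('n::{finite,linorder})}" "set_mset M \<subseteq> {1..CARD('n)}"
    and "size M \<le> length xs"
  shows "\<exists>m>0. fold pd_sigma xs (\<Prod>j\<in>#M. sigma j :: 'n ratfun) = (if mset xs = M then of_nat m else 0)"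
  using assms
proof (induction xs arbitrary: M)
  case Nil
  then show ?case by (auto intro!: exI[of _ 1])
next
  case (Cons h xs)
  have h: "h \<in> {1..CARD('n)}" using Cons.prems by simp
  let ?M = "M - {#h#}"
  have eq: "fold pd_sigma (h # xs) (\<Prod>j\<in>#M. sigma j :: 'n ratfun) =
      of_nat (count M h) * fold pd_sigma xs (\<Prod>j\<in>#?M. sigma j)"
    using fold_pd_sigma_const_mult[of xs "of_nat (count M h)", where ?'n = 'n] Cons.prems
    by (simp add: pd_sigma_prod_sigma const_rat_of_nat)
  show ?case
  proof (cases "h \<in># M")
    case True
    then have "size ?M \<le> length xs" using Cons.prems by (simp add: size_Diff_singleton)
    moreover have "set_mset ?M \<subseteq> {1..CARD('n)}"
      using Cons.prems(2) by (auto dest: in_diffD)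
    ultimately obtain m where m: "m > 0"
      "fold pd_sigma xs (\<Prod>j\<in>#?M. sigma j :: 'n ratfun) = (if mset xs = ?M then of_nat m else 0)"
      using Cons.IH[of ?M] Cons.prems(1) by auto
    have "mset xs = ?M \<longleftrightarrow> mset (h # xs) = M"
      using True by (metis add_mset_remove_trivial insert_DiffM mset.simps(2))
    then show ?thesis
      using m True unfolding eq
      by (intro exI[of _ "count M h * m"]) auto
  next
    case False
    then have "mset (h # xs) \<noteq> M" by auto
    \<comment> \<open>Here \<open>count M h\<close> is 0, so the value is 0 and any positive
      \<open>m\<close> will do.\<close>
    then show ?thesis
      using False unfolding eq by (intro exI[of _ 1]) (auto simp: not_in_iff)
  qed
qed

text \<open>The values of the \<partial>^N on the monomials in the \<sigma>_h thus form a matrix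
  that is triangular with respect to \<open>size\<close>, with positive integers on the
  diagonal.\<close>

lemma dmon_prod_sigma:
  assumes "set_mset N \<subseteq> {1..CARD('n::{finite,linorder})}" "set_mset M \<subseteq> {1..CARD('n)}"
  shows "size M \<le> size N \<Longrightarrow> N \<noteq> M \<Longrightarrow> dmon N (\<Prod>j\<in>#M. sigma j :: 'n ratfun) = 0"
    and "\<exists>m>0. dmon M (\<Prod>j\<in>#M. sigma j :: 'n ratfun) = of_nat m"
proof -
  have len: "length (sorted_list_of_multiset K) = size K" for K :: "nat multiset"
    by (metis mset_sorted_list_of_multiset size_mset)
  show "dmon N (\<Prod>j\<in>#M. sigma j :: 'n ratfun) = 0" if "size M \<le> size N" "N \<noteq> M"
    using fold_pd_sigma_prod_sigma[of "sorted_list_of_multiset N" M, where ?'n = 'n] assms that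
    by (auto simp: dmon_def len)
  show "\<exists>m>0. dmon M (\<Prod>j\<in>#M. sigma j :: 'n ratfun) = of_nat m"
    using fold_pd_sigma_prod_sigma[of "sorted_list_of_multiset M" M, where ?'n = 'n] assms
    by (auto simp: dmon_def len)
qed

lemma dmon_sring:
  assumes "set_mset M \<subseteq> {1..CARD('n::{finite,linorder})}" "f \<in> (sring :: 'n ratfun set)"
  shows "dmon M f \<in> sring"
proof -
  have "fold pd_sigma xs f \<in> sring" if "set xs \<subseteq> {1..CARD('n)}" for xs
    using that assms(2)
  proof (induction xs arbitrary: f)
    case (Cons h xs)
    then have "pd_sigma h f \<in> sring" by (intro pd_sigma_sring) simp_all
    then show ?case using Cons by simp
  qed simp
  then show ?thesis using assms by (simp add: dmon_def)
qed

section \<open>The left \<complex>(z)-span of the \<partial>^M and its normal form\<close>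

inductive_set dspan :: "'n::{finite,linorder} ratop set" where
  mon: "set_mset M \<subseteq> {1..CARD('n)} \<Longrightarrow> (\<lambda>f. c * dmon M f) \<in> dspan"
| add: "P \<in> dspan \<Longrightarrow> Q \<in> dspan \<Longrightarrow> (\<lambda>f. P f + Q f) \<in> dspan"

lemma dspan_id: "id \<in> dspan"
  using dspan.mon[of "{#}" 1] by (simp add: id_def)

lemma dspan_sum:
  "(\<And>x. x \<in> X \<Longrightarrow> P x \<in> dspan) \<Longrightarrow> (\<lambda>f. \<Sum>x\<in>X. P x f) \<in> dspan"
  using dspan.mon[of "{#}" 0]
  by (induction X rule: infinite_finite_induct) (auto intro: dspan.add)

lemma dspan_mult:
  assumes "P \<in> dspan" shows "(\<lambda>f. a * P f) \<in> dspan"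
  using assms
proof induction
  case (mon M c)
  then show ?case using dspan.mon[of M "a * c"] by (simp add: mult.assoc)
qed (simp add: distrib_left dspan.add)

text \<open>By the Leibniz rule, \<partial>_h composed with c \<partial>^M is (\<partial>_h c)
  \<partial>^M + c \<partial>_h \<partial>^M, again with coefficients on the left.\<close>

lemma dspan_pd_sigma:
  assumes h: "h \<in> {1..CARD('n)}" and "P \<in> (dspan :: 'n::{finite,linorder} ratop set)"
  shows "(\<lambda>f. pd_sigma h (P f)) \<in> dspan"
  using assms(2)
proof induction
  case (mon M c)
  have "(\<lambda>f. pd_sigma h c * dmon M f + c * dmon (add_mset h M) f) \<in> dspan"
    using mon h by (intro dspan.intros) auto
  then show ?case
    using mon h by (simp add: derivation_simps[OF derivation_pd_sigma[OF h]] dmon_add)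
qed (simp add: derivation_simps[OF derivation_pd_sigma[OF h]] dspan.add)

text \<open>The chain rule: both sides are derivations that agree on the
  \<open>sigma j\<close>.\<close>

lemma pd_z_eq:
  "pd_z i f = (\<Sum>h\<in>{1..CARD('n)}. pd_z i (sigma h) * pd_sigma h (f :: 'n::{finite,linorder} ratfun))"
proof -
  have "pd_z i = (\<lambda>f. \<Sum>h\<in>{1..CARD('n)}. pd_z i (sigma h) * pd_sigma h (f :: 'n ratfun))"
  proof (rule derivation_eqI_sigma)
    fix j assume j: "j \<in> {1..CARD('n)}"
    have "(\<Sum>h\<in>{1..CARD('n)}. pd_z i (sigma h) * pd_sigma h (sigma j :: 'n ratfun)) =
        (\<Sum>h\<in>{1..CARD('n)}. if h = j then pd_z i (sigma h) else 0)"
      using j by (intro sum.cong) (auto simp: pd_sigma_sigma)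
    then show "pd_z i (sigma j) = (\<Sum>h\<in>{1..CARD('n)}. pd_z i (sigma h) * pd_sigma h (sigma j :: 'n ratfun))"
      using j by simp
  next
    show "derivation (\<lambda>f. \<Sum>h\<in>{1..CARD('n)}. pd_z i (sigma h) * pd_sigma h (f :: 'n ratfun))"
      by (intro derivation_combination derivation_pd_sigma)
  qed (rule derivation_pd_z)
  then show ?thesis by (rule fun_cong)
qed

text \<open>An arbitrary \<open>Q\<close> lets a composition in \<open>W1\<close> be absorbed one
  factor at a time; the choice \<open>id\<close> for \<open>Q\<close> places \<open>A\<close> itself
  in \<open>dspan\<close>.\<close>

lemma W1_dspan:
  assumes "A \<in> W1" "Q \<in> (dspan :: 'n::{finite,linorder} ratop set)" shows "A \<circ> Q \<in> dspan"
  using assms unfolding W1_def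
proof (induction arbitrary: Q rule: op_algebra.induct)
  case (generator P)
  have "(\<lambda>f. pd_z i (Q f)) \<in> dspan" for i :: 'n
  proof -
    have "(\<lambda>f. \<Sum>h\<in>{1..CARD('n)}. pd_z i (sigma h) * pd_sigma h (Q f)) \<in> dspan"
      using generator.prems by (intro dspan_sum dspan_mult dspan_pd_sigma)
    then show ?thesis by (simp only: pd_z_eq[symmetric])
  qed
  then show ?case
    using generator by (auto simp: mult_op_def comp_def dspan_mult)
next
  case (mult P P')
  then show ?case by (simp add: comp_assoc)
qed (auto simp: mult_op_def comp_def dspan_mult dspan.add)

text \<open>Like terms are collected, so that each multiset carries a single coefficient that can be
  recovered later.\<close>

lemma dspan_normal_form:
  assumes "P \<in> (dspan :: 'n::{finite,linorder} ratop set)"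
  obtains F c where "finite F" "\<And>M. M \<in> F \<Longrightarrow> set_mset M \<subseteq> {1..CARD('n)}"
    "P = (\<lambda>f. \<Sum>M\<in>F. c M * dmon M f)"
proof -
  have "\<exists>F c. finite F \<and> (\<forall>M\<in>F. set_mset M \<subseteq> {1..CARD('n)}) \<and> P = (\<lambda>f. \<Sum>M\<in>F. c M * dmon M f)"
    using assms
  proof induction
    case (mon M c)
    then show ?case by (intro exI[of _ "{M}"] exI[of _ "\<lambda>_. c"]) auto
  next
    case (add P Q)
    then obtain F c G d where F: "finite F" "\<forall>M\<in>F. set_mset M \<subseteq> {1..CARD('n)}"
        "P = (\<lambda>f. \<Sum>M\<in>F. c M * dmon M f)"
      and G: "finite G" "\<forall>M\<in>G. set_mset M \<subseteq> {1..CARD('n)}"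
        "Q = (\<lambda>f. \<Sum>M\<in>G. d M * dmon M f)"
      by blast
    let ?e = "\<lambda>M. (if M \<in> F then c M else 0) + (if M \<in> G then d M else 0)"
    have "P f = (\<Sum>M\<in>F \<union> G. (if M \<in> F then c M else 0) * dmon M f)" for f
      unfolding F(3) by (rule sum.mono_neutral_cong_left) (use F(1) G(1) in auto)
    moreover have "Q f = (\<Sum>M\<in>F \<union> G. (if M \<in> G then d M else 0) * dmon M f)" for f
      unfolding G(3) by (rule sum.mono_neutral_cong_left) (use F(1) G(1) in auto)
    ultimately have "(\<lambda>f. P f + Q f) = (\<lambda>f. \<Sum>M\<in>F \<union> G. ?e M * dmon M f)"
      by (simp only: distrib_right sum.distrib)
    then show ?case
      using F(1,2) G(1,2) by (intro exI[of _ "F \<union> G"] exI[of _ ?e]) auto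
  qed
  then show ?thesis using that by blast
qed

text \<open>
  The coefficients are recovered one after the other, by increasing order, from the values of the
  operator on the monomials in the \<open>\<sigma>\<^sub>h\<close>.
\<close>

lemma coefficient_in_sring:
  fixes c :: "nat multiset \<Rightarrow> 'n::{finite,linorder} ratfun"
  assumes F: "finite F" "\<And>M. M \<in> F \<Longrightarrow> set_mset M \<subseteq> {1..CARD('n)}"
    and P: "\<And>f. f \<in> sring \<Longrightarrow> (\<Sum>M\<in>F. c M * dmon M f) \<in> sring"
    and "M \<in> F"
  shows "c M \<in> sring"
  using \<open>M \<in> F\<close>
proof (induction "size M" arbitrary: M rule: less_induct)
  case less
  define s :: "'n ratfun" where "s = (\<Prod>j\<in>#M. sigma j)"
  define L where "L = {N \<in> F. size N < size M}"
  have M: "set_mset M \<subseteq> {1..CARD('n)}" using F(2) less.prems .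
  have s: "s \<in> sring"
    unfolding s_def using M
  proof (induction M)
    case (add x M)
    then have "sigma x \<in> (sring :: 'n ratfun set)"
      unfolding sring_def by (intro subalg.gen) auto
    then show ?case using add by (auto simp: sring_def intro: subalg.mult)
  qed (simp add: sring_def)
  obtain m where m: "m > 0" "dmon M s = of_nat m"
    using dmon_prod_sigma(2)[OF M M] by (auto simp: s_def)
  \<comment> \<open>By triangularity only \<open>M\<close> and multisets of smaller size contribute;
    the coefficients of the latter are in \<complex>[\<sigma>] by induction.\<close>
  have "(\<Sum>N\<in>F. c N * dmon N s) = (\<Sum>N\<in>insert M L. c N * dmon N s)"
  proof (rule sum.mono_neutral_right)
    show "\<forall>N\<in>F - insert M L. c N * dmon N s = 0"
    proof
      fix N assume "N \<in> F - insert M L"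
      then have "N \<in> F" "size M \<le> size N" "N \<noteq> M" by (auto simp: L_def)
      then show "c N * dmon N s = 0"
        using dmon_prod_sigma(1)[OF F(2) M] by (simp add: s_def)
    qed
  qed (use F less.prems in \<open>auto simp: L_def\<close>)
  also have "\<dots> = c M * of_nat m + (\<Sum>N\<in>L. c N * dmon N s)"
    using F(1) m by (subst sum.insert) (auto simp: L_def)
  finally have eq: "c M * of_nat m = (\<Sum>N\<in>F. c N * dmon N s) - (\<Sum>N\<in>L. c N * dmon N s)"
    by simp
  have "(\<Sum>N\<in>L. c N * dmon N s) \<in> sring"
    unfolding sring_def
  proof (intro subalg_sum subalg.mult)
    fix N assume N: "N \<in> L"
    show "c N \<in> subalg (sigma ` {1..CARD('n)})"
      using less.hyps[of N] N by (auto simp: L_def sring_def)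
    show "dmon N s \<in> subalg (sigma ` {1..CARD('n)})"
      using dmon_sring[OF F(2) s, of N] N by (auto simp: L_def sring_def)
  qed
  then have cm: "c M * of_nat m \<in> sring"
    unfolding eq using P[OF s] by (simp add: sring_def subalg_diff)
  \<comment> \<open>Dividing by the positive integer \<open>m\<close> is multiplication by a
    constant, which stays in \<complex>[\<sigma>].\<close>
  have "c M = const_rat (inverse (of_nat m)) * (c M * of_nat m)"
    using const_rat_inverse_mult[of "of_nat m", where ?'a = 'n] m(1)
    by (simp add: const_rat_of_nat mult_ac)
  also have "\<dots> \<in> sring"
    using cm unfolding sring_def by (rule subalg.mult[OF subalg.const])
  finally show ?case .
qed

section \<open>Membership in the Weyl algebra \<open>W2\<close>\<close>

lemma mult_op_in_W2: "s \<in> sring \<Longrightarrow> mult_op s \<in> W2"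
  unfolding sring_def
proof (induction rule: subalg.induct)
  case (add f g)
  then have "(\<lambda>h. mult_op f h + mult_op g h) \<in> W2"
    by (auto simp: W2_def intro: op_algebra.add)
  then show ?case by (simp add: mult_op_def distrib_right)
next
  case (mult f g)
  then have "mult_op f \<circ> mult_op g \<in> W2"
    by (auto simp: W2_def intro: op_algebra.mult)
  then show ?case by (simp add: mult_op_def comp_def mult.assoc)
qed (auto simp: W2_def intro: op_algebra.scalar op_algebra.generator)

lemma dmon_in_W2:
  assumes "set_mset M \<subseteq> {1..CARD('n::{finite,linorder})}"
  shows "dmon M \<in> (W2 :: 'n ratop set)"
proof -
  have "fold pd_sigma xs \<in> (W2 :: 'n ratop set)" if "set xs \<subseteq> {1..CARD('n)}" for xs
    using that
  proof (induction xs)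
    case Nil
    have "mult_op (const_rat 1) = (fold pd_sigma [] :: 'n ratop)"
      by (simp add: mult_op_def id_def)
    moreover have "mult_op (const_rat 1) \<in> (W2 :: 'n ratop set)"
      unfolding W2_def by (rule op_algebra.scalar)
    ultimately show ?case by (simp only:)
  next
    case (Cons h xs)
    then have "pd_sigma h \<in> (W2 :: 'n ratop set)"
      unfolding W2_def by (intro op_algebra.generator) auto
    moreover have "fold pd_sigma xs \<in> (W2 :: 'n ratop set)" using Cons by simp
    ultimately have "fold pd_sigma xs \<circ> pd_sigma h \<in> (W2 :: 'n ratop set)"
      unfolding W2_def by (intro op_algebra.mult)
    then show ?case by (simp only: fold.simps)
  qed
  then show ?thesis using assms by (simp add: dmon_def)
qed

lemma W2_sum:
  assumes "\<And>x. x \<in> X \<Longrightarrow> P x \<in> W2" shows "(\<lambda>f. \<Sum>x\<in>X. P x f) \<in> W2"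
  using assms mult_op_in_W2[of 0]
  by (induction X rule: infinite_finite_induct)
    (auto simp: W2_def mult_op_def sring_def intro: op_algebra.add)

text \<open>Stability of \<complex>[\<sigma>] forces every coefficient of the normal form into
  \<complex>[\<sigma>], and then each term is a composition of two elements of
  \<open>W2\<close>.\<close>

lemma dspan_in_W2:
  assumes "P \<in> dspan" "\<And>f. f \<in> sring \<Longrightarrow> P f \<in> sring"
  shows "P \<in> (W2 :: 'n::{finite,linorder} ratop set)"
proof -
  obtain F c where F: "finite F" "\<And>M. M \<in> F \<Longrightarrow> set_mset M \<subseteq> {1..CARD('n)}"
    and P: "P = (\<lambda>f. \<Sum>M\<in>F. c M * dmon M f)"
    using dspan_normal_form[OF assms(1)] by blast
  have "(\<lambda>f. c M * dmon M f) \<in> W2" if "M \<in> F" for M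
  proof -
    have "c M \<in> sring"
      using coefficient_in_sring[OF F _ that, of c] assms(2) by (simp add: P)
    then have "mult_op (c M) \<circ> dmon M \<in> W2"
      using mult_op_in_W2 dmon_in_W2[OF F(2)[OF that]] unfolding W2_def by (intro op_algebra.mult) auto
    then show ?thesis by (simp add: mult_op_def comp_def)
  qed
  then show ?thesis unfolding P by (rule W2_sum)
qed

theorem theorem3p2p1:
  fixes A :: "'n::{finite,linorder} ratop"
  assumes "A \<in> W1" and "antisymmetric_op A"
  shows "mult_op delta \<circ> A \<in> (\<lambda>P. mult_op Delta \<circ> P) ` W2 \<and>
         A \<in> (\<lambda>P. mult_op delta \<circ> P) ` W2"
proof -
  \<comment> \<open>Both claims follow from this one quotient: A = \<delta> P, and hence \<delta> A
    = \<Delta> P.\<close>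
  define P where "P = mult_op (inverse delta) \<circ> A"
  have "P \<in> dspan"
    using dspan_mult[OF W1_dspan[OF assms(1) dspan_id], of "inverse delta"]
    by (simp add: P_def mult_op_def comp_def)
  moreover have "P s \<in> sring" if s: "s \<in> sring" for s
  proof -
    have "A s \<in> zring"
      using W1_zring[OF assms(1)] s sring_subset_zring by blast
    moreover have "perm_rat \<tau> (A s) = of_int (sign \<tau>) * A s" if \<tau>: "\<tau> permutes UNIV" for \<tau>
    proof -
      \<comment> \<open>Conjugation by \<tau> first applies the inverse of \<tau> to the argument,
        which fixes the symmetric \<open>s\<close>; so the anti-symmetry of \<open>A\<close> passes
        to the function \<open>A s\<close>.\<close>
      have "perm_rat (inv \<tau>) s = s"
        using permutes_bij[OF permutes_inv[OF \<tau>]] s by (rule perm_rat_sring)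
      then have "perm_rat \<tau> (A s) = perm_op \<tau> A s"
        by (simp add: perm_op_def)
      also have "perm_op \<tau> A = mult_op (of_int (sign \<tau>)) \<circ> A"
        using assms(2) \<tau> by (simp only: antisymmetric_op_def)
      finally show ?thesis by (simp add: mult_op_def)
    qed
    ultimately have "inverse delta * A s \<in> sring"
      by (rule antisymmetric_zring)
    then show ?thesis by (simp add: P_def mult_op_def)
  qed
  ultimately have "P \<in> W2" by (rule dspan_in_W2)
  moreover have A: "A = mult_op delta \<circ> P"
    by (simp add: P_def mult_op_def comp_def delta_neq_0 flip: mult.assoc)
  moreover have "mult_op delta \<circ> A = mult_op Delta \<circ> P"
    unfolding A by (simp add: mult_op_def comp_def Delta_def power2_eq_square mult.assoc)
  ultimately show ?thesis by blast
qed

end
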